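(* Let $\mathbb{H}=W_1[0,1]$ be the Sobolev space of absolutely continuous functions on $[0,1]$ with square-integrable derivative, with norm $\|g\|_{\mathbb{H}}^2=|g(0)|^2+\int_0^1|g'(t)|^2dt$. Fix $\theta\in\mathbb{R}^d$ and let the positive trace-class operator $f(\theta)$ on $\mathbb{H}$ have the eigendecomposition $$f(\theta)=\sum_{j=1}^\infty\nu_j\,\phi_j\otimes\phi_j,$$ where the eigenvalues $\nu_j$ are summable. Assume that, for each $j$, the derivative $\phi_j'$ is Lipschitz continuous with $|\phi_j'(s)-\phi_j'(t)|\le C_j|s-t|$ for some finite constant $C_j$, where $\sum_{j=1}^\infty C_j\nu_j^2<\infty$. Also assume that the sampling design is $u_{n,i}=i/m_n$, $0\le i\le m_n$ (with $m_n\to\infty$). Then $$\|\tilde f(\theta)-f(\theta)\|_{\rm HS}=\mathcal{O}(m_n^{-1/2}),$$ where $\tilde f(\theta)=\Pi_nf(\theta)\Pi_n$ and $\Pi_n$ is the orthogonal projection of $\mathbb{H}$ onto ${\rm span}\{R(u_{n,i},\cdot):0\le i\le m_n\}$, $R$ being the reproducing kernel of $\mathbb{H}$.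
   Context: $\mathbb{H}=W_1[0,1]$ (complex-valued functions) has inner product $\langle g,h\rangle_{\mathbb{H}}=g(0)\overline{h(0)}+\int_0^1g'(t)\overline{h'(t)}\,dt$ and is a reproducing kernel Hilbert space with kernel $R(s,t)=1+\min(s,t)$. $\{\phi_j\}$ are orthonormal eigenfunctions in $\mathbb{H}$; $x\otimes y$ is the operator $z\mapsto x\langle z,y\rangle_{\mathbb{H}}$; $\|\cdot\|_{\rm HS}$ is the Hilbert–Schmidt norm of operators on $\mathbb{H}$. In the paper $f(\theta)$ is the spectral density at $\theta$ of an $\mathbb{H}$-valued second-order stationary process $X$, and $\tilde f(\theta)$ is the spectral density of the projected process $\Pi_nX$. *)

theory Defs
  imports "HOL-Analysis.Analysis" "HOL-Library.Landau_Symbols"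
begin

section \<open>Absolute continuity\<close>

definition abs_continuous_on :: "real set \<Rightarrow> (real \<Rightarrow> 'a::real_normed_vector) \<Rightarrow> bool" where
  "abs_continuous_on S f \<longleftrightarrow>
     (\<forall>\<epsilon>>0. \<exists>\<delta>>0. \<forall>\<D>. \<D> division_of \<Union>\<D> \<and> \<Union>\<D> \<subseteq> S \<and> (\<Sum>K\<in>\<D>. measure lborel K) < \<delta> \<longrightarrow>
        (\<Sum>K\<in>\<D>. norm (f (Sup K) - f (Inf K))) < \<epsilon>)"

lemma abs_continuous_on_lincomb:
  fixes f g :: "real \<Rightarrow> complex"
  assumes f: "abs_continuous_on S f" and g: "abs_continuous_on S g"
  shows "abs_continuous_on S (\<lambda>t. a * f t + b * g t)"
  unfolding abs_continuous_on_def
proof (intro allI impI)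
  fix \<epsilon> :: real assume "\<epsilon> > 0"
  define A where "A = cmod a + cmod b + 1"
  have A: "A > 0" "cmod a \<le> A" "cmod b \<le> A"
    by (auto simp: A_def add_nonneg_pos)
  have e: "\<epsilon> / (2 * A) > 0" using \<open>\<epsilon> > 0\<close> A by simp
  obtain d1 where d1: "d1 > 0" "\<And>\<D>. \<D> division_of \<Union>\<D> \<Longrightarrow> \<Union>\<D> \<subseteq> S \<Longrightarrow> (\<Sum>K\<in>\<D>. measure lborel K) < d1 \<Longrightarrow>
        (\<Sum>K\<in>\<D>. norm (f (Sup K) - f (Inf K))) < \<epsilon> / (2 * A)"
    using f e unfolding abs_continuous_on_def by meson
  obtain d2 where d2: "d2 > 0" "\<And>\<D>. \<D> division_of \<Union>\<D> \<Longrightarrow> \<Union>\<D> \<subseteq> S \<Longrightarrow> (\<Sum>K\<in>\<D>. measure lborel K) < d2 \<Longrightarrow>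
        (\<Sum>K\<in>\<D>. norm (g (Sup K) - g (Inf K))) < \<epsilon> / (2 * A)"
    using g e unfolding abs_continuous_on_def by meson
  show "\<exists>\<delta>>0. \<forall>\<D>. \<D> division_of \<Union>\<D> \<and> \<Union>\<D> \<subseteq> S \<and> (\<Sum>K\<in>\<D>. measure lborel K) < \<delta> \<longrightarrow>
        (\<Sum>K\<in>\<D>. norm ((a * f (Sup K) + b * g (Sup K)) - (a * f (Inf K) + b * g (Inf K)))) < \<epsilon>"
  proof (intro exI[of _ "min d1 d2"] conjI allI impI; (elim conjE)?)
    show "min d1 d2 > 0" using d1 d2 by simp
    fix \<D> :: "real set set"
    assume D: "\<D> division_of \<Union>\<D>" "\<Union>\<D> \<subseteq> S" "(\<Sum>K\<in>\<D>. measure lborel K) < min d1 d2"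
    have "(\<Sum>K\<in>\<D>. norm ((a * f (Sup K) + b * g (Sup K)) - (a * f (Inf K) + b * g (Inf K))))
       \<le> (\<Sum>K\<in>\<D>. A * norm (f (Sup K) - f (Inf K)) + A * norm (g (Sup K) - g (Inf K)))"
    proof (rule sum_mono)
      fix K
      have "(a * f (Sup K) + b * g (Sup K)) - (a * f (Inf K) + b * g (Inf K))
          = a * (f (Sup K) - f (Inf K)) + b * (g (Sup K) - g (Inf K))"
        by (simp add: algebra_simps)
      also have "norm \<dots> \<le> cmod a * norm (f (Sup K) - f (Inf K)) + cmod b * norm (g (Sup K) - g (Inf K))"
        by (metis norm_mult norm_triangle_ineq)
      also have "\<dots> \<le> A * norm (f (Sup K) - f (Inf K)) + A * norm (g (Sup K) - g (Inf K))"
        by (intro add_mono mult_right_mono A norm_ge_zero)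
      finally show "norm ((a * f (Sup K) + b * g (Sup K)) - (a * f (Inf K) + b * g (Inf K)))
         \<le> A * norm (f (Sup K) - f (Inf K)) + A * norm (g (Sup K) - g (Inf K))" .
    qed
    also have "\<dots> = A * (\<Sum>K\<in>\<D>. norm (f (Sup K) - f (Inf K))) + A * (\<Sum>K\<in>\<D>. norm (g (Sup K) - g (Inf K)))"
      by (simp add: sum.distrib sum_distrib_left)
    also have "\<dots> < A * (\<epsilon> / (2 * A)) + A * (\<epsilon> / (2 * A))"
      using d1(2)[of \<D>] d2(2)[of \<D>] D A
      by (intro add_strict_mono mult_strict_left_mono) auto
    also have "\<dots> = \<epsilon>" using A by simp
    finally show "(\<Sum>K\<in>\<D>. norm ((a * f (Sup K) + b * g (Sup K)) - (a * f (Inf K) + b * g (Inf K)))) < \<epsilon>" .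
  qed
qed

lemma lipschitz_imp_abs_continuous_on:
  assumes L: "\<And>s t. s \<in> S \<Longrightarrow> t \<in> S \<Longrightarrow> norm (f s - f t) \<le> L * \<bar>s - t\<bar>"
  shows "abs_continuous_on S f"
  unfolding abs_continuous_on_def
proof (intro allI impI)
  fix \<epsilon> :: real assume "\<epsilon> > 0"
  define A where "A = \<bar>L\<bar> + 1"
  have A: "A > 0" "L \<le> A" by (auto simp: A_def)
  show "\<exists>\<delta>>0. \<forall>\<D>. \<D> division_of \<Union>\<D> \<and> \<Union>\<D> \<subseteq> S \<and> (\<Sum>K\<in>\<D>. measure lborel K) < \<delta> \<longrightarrow>
        (\<Sum>K\<in>\<D>. norm (f (Sup K) - f (Inf K))) < \<epsilon>"
  proof (intro exI[of _ "\<epsilon> / A"] conjI allI impI; (elim conjE)?)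
    show "\<epsilon> / A > 0" using \<open>\<epsilon> > 0\<close> A by simp
    fix \<D> :: "real set set"
    assume D: "\<D> division_of \<Union>\<D>" "\<Union>\<D> \<subseteq> S" "(\<Sum>K\<in>\<D>. measure lborel K) < \<epsilon> / A"
    have "(\<Sum>K\<in>\<D>. norm (f (Sup K) - f (Inf K))) \<le> (\<Sum>K\<in>\<D>. A * measure lborel K)"
    proof (rule sum_mono)
      fix K assume K: "K \<in> \<D>"
      then obtain c d where cd: "K = {c..d}" "c \<le> d"
        using division_ofD(3,4)[OF D(1) K] by (metis atLeastatMost_empty_iff2 box_real(2))
      then have "c \<in> K" "d \<in> K" by auto
      then have "c \<in> S" "d \<in> S" using D(2) K by blast+
      then have "norm (f d - f c) \<le> L * \<bar>d - c\<bar>" by (intro L)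
      also have "\<dots> \<le> A * \<bar>d - c\<bar>" using A by (intro mult_right_mono) auto
      finally show "norm (f (Sup K) - f (Inf K)) \<le> A * measure lborel K"
        using cd by simp
    qed
    also have "\<dots> = A * (\<Sum>K\<in>\<D>. measure lborel K)" by (simp add: sum_distrib_left)
    also have "\<dots> < A * (\<epsilon> / A)" using D A by (intro mult_strict_left_mono) auto
    finally show "(\<Sum>K\<in>\<D>. norm (f (Sup K) - f (Inf K))) < \<epsilon>" using A by simp
  qed
qed

text \<open>The fundamental theorem of calculus for absolutely continuous functions.\<close>

lemma abs_continuous_has_integral:
  fixes f :: "real \<Rightarrow> 'a::banach"
  assumes "a \<le> b" and ac: "abs_continuous_on {a..b} f" and neg: "negligible N"
    and vecd: "\<And>x. x \<in> {a..b} - N \<Longrightarrow> (f has_vector_derivative f' x) (at x within {a..b})"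
  shows "(f' has_integral (f b - f a)) {a..b}"
proof (cases "a = b")
  case True then show ?thesis by auto
next
  case False
  then have ab: "a < b" using assms by simp
  define h where "h = (\<lambda>x. if x \<in> N then 0 else f' x)"
  have "(h has_integral (f b - f a)) {a..b}"
    unfolding has_integral_factor_content_real
  proof (intro allI impI)
    fix e :: real assume "e > 0"
    define e2 where "e2 = e / 2"
    have e2: "e2 > 0" using \<open>e > 0\<close> by (simp add: e2_def)
    then have "e2 * (b - a) > 0" using ab by simp
    then obtain \<delta> where \<delta>: "\<delta> > 0" "\<And>\<D>. \<D> division_of \<Union>\<D> \<Longrightarrow> \<Union>\<D> \<subseteq> {a..b} \<Longrightarrow> (\<Sum>K\<in>\<D>. measure lborel K) < \<delta> \<Longrightarrow>
        (\<Sum>K\<in>\<D>. norm (f (Sup K) - f (Inf K))) < e2 * (b - a)"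
      using ac unfolding abs_continuous_on_def by meson
    have Nnull: "N \<in> null_sets lebesgue" using neg by (simp add: negligible_iff_null_sets)
    then obtain T where T: "open T" "N \<subseteq> T" "T - N \<in> lmeasurable" "emeasure lebesgue (T - N) < ennreal \<delta>"
      using sets_lebesgue_outer_open[of N \<delta>] \<delta>(1) by blast
    have Tm: "T \<in> sets lebesgue" using T(1) by (simp add: borel_open)
    have emT: "emeasure lebesgue T < ennreal \<delta>"
      using T(4) emeasure_Diff_null_set[OF Nnull Tm] by simp
    then have Tl: "T \<in> lmeasurable"
      using Tm by (intro fmeasurableI) (auto intro: order_less_le_trans)
    then have mT: "measure lebesgue T < \<delta>"
      using emT \<delta>(1) by (simp add: emeasure_eq_measure2 ennreal_less_iff)
    have "\<forall>x. \<exists>d>0. x \<in> {a..b} - N \<longrightarrow>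
         (\<forall>y\<in>{a..b}. norm (y-x) < d \<longrightarrow> norm (f y - f x - (y-x) *\<^sub>R f' x) \<le> e2 * norm (y-x))"
      using vecd[unfolded has_vector_derivative_def has_derivative_within_alt] e2 zero_less_one by blast
    then obtain d where d: "\<And>x. 0 < d x"
                   "\<And>x y. \<lbrakk>x \<in> {a..b} - N; y \<in> {a..b}; norm (y-x) < d x\<rbrakk>
                          \<Longrightarrow> norm (f y - f x - (y-x) *\<^sub>R f' x) \<le> e2 * norm (y-x)"
      by metis
    define \<gamma> where "\<gamma> = (\<lambda>x. if x \<in> N then T else ball x (d x))"
    show "\<exists>\<gamma>. gauge \<gamma> \<and> (\<forall>p. p tagged_division_of {a..b} \<and> \<gamma> fine p \<longrightarrow>
      norm ((\<Sum>(x, k)\<in>p. measure lborel k *\<^sub>R h x) - (f b - f a)) \<le> e * measure lborel {a..b})"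
    proof (intro exI[of _ \<gamma>] conjI allI impI; (elim conjE)?)
      show "gauge \<gamma>" using T d(1) by (auto simp: gauge_def \<gamma>_def)
      fix p assume ptag: "p tagged_division_of {a..b}" and finep: "\<gamma> fine p"
      have fin: "finite p" using ptag by blast
      define E where "E = (\<lambda>(x, K). measure lborel K *\<^sub>R h x - (f (Sup K) - f (Inf K)))"
      define p1 where "p1 = {(x, K) \<in> p. x \<in> N}"
      have p1: "p1 \<subseteq> p" by (auto simp: p1_def)
      have tpd: "p1 tagged_partial_division_of {a..b}"
        using tagged_partial_division_subset[OF _ p1, of "{a..b}"] ptag unfolding tagged_division_of_def by simp
      have dv: "(snd ` p1) division_of \<Union>(snd ` p1)"
        by (rule partial_division_of_tagged_division[OF tpd])
      have zero: "measure lborel K = 0 \<and> norm (f (Sup K) - f (Inf K)) = 0"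
        if xyK: "(x, K) \<in> p" "(y, K) \<in> p" "x \<noteq> y" for x y K
      proof -
        have "interior K \<inter> interior K = {}"
          using tagged_division_ofD(5)[OF ptag xyK(1,2)] xyK(3) by blast
        moreover obtain c d where K: "K = cbox c d"
          using tagged_division_ofD(4)[OF ptag xyK(1)] by blast
        moreover have "x \<in> K" by (rule tagged_division_ofD(2)[OF ptag xyK(1)])
        ultimately have "c = d" by auto
        with K show ?thesis by simp
      qed
      have "(\<Sum>K\<in>snd ` p1. measure lborel K) = measure lebesgue (\<Union>(snd ` p1))"
        unfolding content_division[OF dv, symmetric]
      proof (rule sum.cong[OF refl])
        fix K assume "K \<in> snd ` p1"
        then obtain c d where "K = cbox c d" using division_ofD(4)[OF dv] by blast
        then show "measure lborel K = measure lebesgue K" by (simp add: measure_completion)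
      qed
      also have "\<dots> \<le> measure lebesgue T"
      proof (rule measure_mono_fmeasurable)
        show "\<Union>(snd ` p1) \<subseteq> T"
        proof clarify
          fix z x K assume "(x, K) \<in> p1" "z \<in> snd (x, K)"
          then have "z \<in> \<gamma> x" "x \<in> N" using finep by (auto simp: fine_def p1_def)
          then show "z \<in> T" by (simp add: \<gamma>_def)
        qed
        show "\<Union>(snd ` p1) \<in> sets lebesgue"
          by (rule fmeasurableD[OF lmeasurable_division[OF dv]])
      qed (rule Tl)
      also note mT
      finally have small: "(\<Sum>K\<in>snd ` p1. measure lborel K) < \<delta>" .
      have "norm (sum E p1) \<le> (\<Sum>(x, K)\<in>p1. norm (f (Sup K) - f (Inf K)))"
        by (rule sum_norm_le) (auto simp: E_def h_def p1_def norm_minus_commute)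
      also have "\<dots> = (\<Sum>K\<in>snd ` p1. norm (f (Sup K) - f (Inf K)))"
      proof (subst sum.reindex_nontrivial)
        show "finite p1" using fin p1 finite_subset by blast
        fix u v assume "u \<in> p1" "v \<in> p1" "u \<noteq> v" "snd u = snd v"
        then show "norm (f (Sup (snd u)) - f (Inf (snd u))) = 0"
          using zero[of "fst u" "snd u" "fst v"] p1 by (metis prod.collapse prod_eqI subsetD)
      qed (simp add: split_def)
      also have "\<dots> < e2 * (b - a)"
      proof (rule \<delta>(2)[OF dv _ small])
        show "\<Union>(snd ` p1) \<subseteq> {a..b}"
          using tpd unfolding tagged_partial_division_of_def by force
      qed
      finally have E1: "norm (sum E p1) \<le> e2 * (b - a)" by simp
      have "norm (sum E (p - p1)) \<le> (\<Sum>(x, K)\<in>p - p1. e2 * measure lborel K)"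
      proof (rule sum_norm_le, safe)
        fix x K assume xK: "(x, K) \<in> p" "(x, K) \<notin> p1"
        then have xN: "x \<notin> N" by (auto simp: p1_def)
        have xin: "x \<in> K" "K \<subseteq> {a..b}"
          using tagged_division_ofD(2,3)[OF ptag xK(1)] by auto
        obtain u v where "K = cbox u v"
          using tagged_division_ofD(4)[OF ptag xK(1)] by blast
        with xin have K: "K = {u..v}" "u \<le> v" by auto
        have "K \<subseteq> \<gamma> x" using finep xK(1) unfolding fine_def by blast
        then have ball: "K \<subseteq> ball x (d x)" using xN by (simp add: \<gamma>_def)
        have uv: "u \<in> K" "v \<in> K" using K by auto
        have *: "norm (f y - f x - (y - x) *\<^sub>R f' x) \<le> e2 * norm (y - x)" if "y \<in> K" for y
          using that ball xin xN by (intro d(2)) (auto simp: dist_real_def subset_iff abs_minus_commute)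
        have "norm ((v - u) *\<^sub>R f' x - (f v - f u)) = norm ((f u - f x - (u - x) *\<^sub>R f' x) - (f v - f x - (v - x) *\<^sub>R f' x))"
          by (auto simp: algebra_simps)
        also have "\<dots> \<le> norm (f u - f x - (u - x) *\<^sub>R f' x) + norm (f v - f x - (v - x) *\<^sub>R f' x)"
          by (rule norm_triangle_ineq4)
        also have "\<dots> \<le> e2 * norm (u - x) + e2 * norm (v - x)"
          using * uv by (intro add_mono) auto
        also have "\<dots> = e2 * (v - u)"
          using xin K by (auto simp: algebra_simps)
        finally show "norm (E (x, K)) \<le> e2 * measure lborel K"
          using K xN by (simp add: E_def h_def)
      qed
      also have "\<dots> \<le> (\<Sum>(x, K)\<in>p. e2 * measure lborel K)"
        using fin e2 by (intro sum_mono2) auto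
      also have "\<dots> = e2 * (b - a)"
        using additive_content_tagged_division[of p a b] ptag ab
        by (simp add: sum_distrib_left[symmetric] split_def)
      finally have E2: "norm (sum E (p - p1)) \<le> e2 * (b - a)" .
      have "(\<Sum>(x, k)\<in>p. measure lborel k *\<^sub>R h x) - (f b - f a) = sum E p"
        using additive_tagged_division_1[OF \<open>a \<le> b\<close> ptag, of f]
        by (simp add: E_def split_def sum_subtractf)
      also have "\<dots> = sum E (p - p1) + sum E p1"
        using fin p1 by (rule sum.subset_diff[rotated])
      also have "norm \<dots> \<le> e2 * (b - a) + e2 * (b - a)"
        using E1 E2 by (rule norm_triangle_mono[rotated])
      finally show "norm ((\<Sum>(x, k)\<in>p. measure lborel k *\<^sub>R h x) - (f b - f a)) \<le> e * measure lborel {a..b}"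
        using ab by (simp add: e2_def)
    qed
  qed
  then show ?thesis
    by (rule has_integral_spike[OF neg, rotated]) (auto simp: h_def)
qed


section \<open>The Sobolev space \<open>W\<^sub>1[0,1]\<close>\<close>

definition D01 :: "(real \<Rightarrow> complex) \<Rightarrow> real \<Rightarrow> complex" where
  "D01 g t = vector_derivative g (at t within {0..1})"

text \<open>
  Functions on \<open>[0,1]\<close> are represented by functions on the reals that vanish outside \<open>[0,1]\<close>.
  An absolutely continuous function is differentiable almost everywhere; this is listed as a
  separate clause only because \<^const>\<open>D01\<close> is an arbitrary value at points where \<open>g\<close> is not
  differentiable.
\<close>

definition is_w1 :: "(real \<Rightarrow> complex) \<Rightarrow> bool" where
  "is_w1 g \<longleftrightarrow>
     (\<forall>t. t \<notin> {0..1} \<longrightarrow> g t = 0) \<and>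
     abs_continuous_on {0..1} g \<and>
     (AE t in lebesgue_on {0..1}. g differentiable (at t within {0..1})) \<and>
     D01 g \<in> borel_measurable (lebesgue_on {0..1}) \<and>
     integrable (lebesgue_on {0..1}) (\<lambda>t. (cmod (D01 g t))\<^sup>2)"

lemma at_within_01_nontrivial: "t \<in> {0..1} \<Longrightarrow> at t within {0..1::real} \<noteq> bot"
  by (simp add: trivial_limit_within islimpt_Icc)

lemma D01_eq:
  "t \<in> {0..1} \<Longrightarrow> (g has_vector_derivative d) (at t within {0..1}) \<Longrightarrow> D01 g t = d"
  unfolding D01_def by (rule vector_derivative_within[OF at_within_01_nontrivial])

lemma borel_measurable_lebesgue_on_AE:
  fixes f g :: "real \<Rightarrow> complex"
  assumes f: "f \<in> borel_measurable (lebesgue_on {0..1})"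
    and ae: "AE t in lebesgue_on {0..1}. f t = g t"
  shows "g \<in> borel_measurable (lebesgue_on {0..1})"
proof -
  have "(\<lambda>t. if t \<in> {0..1} then f t else 0) \<in> borel_measurable lebesgue"
    using f by (subst borel_measurable_if) auto
  moreover have "AE t in lebesgue. (if t \<in> {0..1} then f t else 0) = (if t \<in> {0..1} then g t else 0)"
    using ae by (simp add: AE_restrict_space_iff)
  ultimately have "(\<lambda>t. if t \<in> {0..1} then g t else 0) \<in> borel_measurable lebesgue"
    by (rule borel_measurable_AE)
  then show ?thesis using borel_measurable_if[of "{0..1}" g] by simp
qed

lemma AE_D01_lincomb:
  assumes "AE t in lebesgue_on {0..1}. g differentiable (at t within {0..1})"
    and "AE t in lebesgue_on {0..1}. h differentiable (at t within {0..1})"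
  shows "AE t in lebesgue_on {0..1}.
     (\<lambda>s. a * g s + b * h s) differentiable (at t within {0..1}) \<and>
     D01 (\<lambda>s. a * g s + b * h s) t = a * D01 g t + b * D01 h t"
proof -
  have sp: "AE t in lebesgue_on {0..1}. t \<in> {0..1::real}" by (rule AE_I2) auto
  show ?thesis
    using assms sp
  proof eventually_elim
    case (elim t)
    then have "(g has_vector_derivative D01 g t) (at t within {0..1})"
      "(h has_vector_derivative D01 h t) (at t within {0..1})"
      by (simp_all add: D01_def vector_derivative_works)
    then have *: "((\<lambda>s. a * g s + b * h s) has_vector_derivative (a * D01 g t + b * D01 h t)) (at t within {0..1})"
      by (intro derivative_intros)
    then show ?case using elim D01_eq[OF _ *] by (metis differentiableI_vector)
  qed
qed

lemma integrable_square_lincomb: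
  fixes g h :: "real \<Rightarrow> complex"
  assumes m: "g \<in> borel_measurable M" "h \<in> borel_measurable M"
    and i: "integrable M (\<lambda>t. (cmod (g t))\<^sup>2)" "integrable M (\<lambda>t. (cmod (h t))\<^sup>2)"
  shows "integrable M (\<lambda>t. (cmod (a * g t + b * h t))\<^sup>2)"
proof (rule Bochner_Integration.integrable_bound)
  show "integrable M (\<lambda>t. 2 * (cmod a)\<^sup>2 * (cmod (g t))\<^sup>2 + 2 * (cmod b)\<^sup>2 * (cmod (h t))\<^sup>2)"
    using i by simp
  show "(\<lambda>t. (cmod (a * g t + b * h t))\<^sup>2) \<in> borel_measurable M"
    using m by measurable
  have "(cmod (a * g t + b * h t))\<^sup>2 \<le> 2 * (cmod a)\<^sup>2 * (cmod (g t))\<^sup>2 + 2 * (cmod b)\<^sup>2 * (cmod (h t))\<^sup>2" for t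
  proof -
    have "(cmod (a * g t + b * h t))\<^sup>2 \<le> (cmod a * cmod (g t) + cmod b * cmod (h t))\<^sup>2"
      by (intro power_mono) (metis norm_mult norm_triangle_ineq, simp)
    also have "\<dots> \<le> 2 * (cmod a * cmod (g t))\<^sup>2 + 2 * (cmod b * cmod (h t))\<^sup>2"
      using sum_squares_bound[of "cmod a * cmod (g t)" "cmod b * cmod (h t)"]
      by (simp add: power2_sum)
    finally show ?thesis by (simp add: power_mult_distrib)
  qed
  then show "AE t in M. norm ((cmod (a * g t + b * h t))\<^sup>2)
      \<le> norm (2 * (cmod a)\<^sup>2 * (cmod (g t))\<^sup>2 + 2 * (cmod b)\<^sup>2 * (cmod (h t))\<^sup>2)"
    by (auto intro!: AE_I2 order_trans[OF _ abs_ge_self])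
qed

lemma integrable_square_mult:
  fixes g h :: "real \<Rightarrow> complex"
  assumes m: "g \<in> borel_measurable M" "h \<in> borel_measurable M"
    and i: "integrable M (\<lambda>t. (cmod (g t))\<^sup>2)" "integrable M (\<lambda>t. (cmod (h t))\<^sup>2)"
  shows "integrable M (\<lambda>t. g t * cnj (h t))"
proof (rule Bochner_Integration.integrable_bound)
  show "integrable M (\<lambda>t. (cmod (g t))\<^sup>2 + (cmod (h t))\<^sup>2)"
    using i by simp
  have "(\<lambda>t. cnj (h t)) \<in> borel_measurable M"
    by (rule measurable_compose[OF m(2)]) (intro borel_measurable_continuous_onI continuous_intros)
  then show "(\<lambda>t. g t * cnj (h t)) \<in> borel_measurable M"
    using m(1) by measurable
  have "cmod (g t) * cmod (h t) \<le> (cmod (g t))\<^sup>2 + (cmod (h t))\<^sup>2" for t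
    using sum_squares_bound[of "cmod (g t)" "cmod (h t)"] mult_nonneg_nonneg[OF norm_ge_zero norm_ge_zero, of "g t" "h t"]
    by linarith
  then show "AE t in M. norm (g t * cnj (h t)) \<le> norm ((cmod (g t))\<^sup>2 + (cmod (h t))\<^sup>2)"
    by (auto simp: norm_mult)
qed

lemma is_w1_lincomb:
  assumes g: "is_w1 g" and h: "is_w1 h"
  shows "is_w1 (\<lambda>t. a * g t + b * h t)"
proof -
  have ae: "AE t in lebesgue_on {0..1}.
     (\<lambda>s. a * g s + b * h s) differentiable (at t within {0..1}) \<and>
     D01 (\<lambda>s. a * g s + b * h s) t = a * D01 g t + b * D01 h t"
    using g h by (intro AE_D01_lincomb) (simp_all add: is_w1_def)
  have m: "D01 g \<in> borel_measurable (lebesgue_on {0..1})" "D01 h \<in> borel_measurable (lebesgue_on {0..1})"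
    using g h by (simp_all add: is_w1_def)
  have i: "integrable (lebesgue_on {0..1}) (\<lambda>t. (cmod (a * D01 g t + b * D01 h t))\<^sup>2)"
    using g h by (intro integrable_square_lincomb) (simp_all add: is_w1_def)
  have m1: "(\<lambda>t. a * D01 g t + b * D01 h t) \<in> borel_measurable (lebesgue_on {0..1})"
    using m by measurable
  have m2: "D01 (\<lambda>t. a * g t + b * h t) \<in> borel_measurable (lebesgue_on {0..1})"
    using m1 by (rule borel_measurable_lebesgue_on_AE) (use ae in \<open>auto elim: eventually_mono\<close>)
  have "integrable (lebesgue_on {0..1}) (\<lambda>t. (cmod (D01 (\<lambda>t. a * g t + b * h t) t))\<^sup>2)"
    using i
  proof (rule Bochner_Integration.integrable_cong_AE_imp)
    show "(\<lambda>t. (cmod (D01 (\<lambda>t. a * g t + b * h t) t))\<^sup>2) \<in> borel_measurable (lebesgue_on {0..1})"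
      using m2 by measurable
    show "AE t in lebesgue_on {0..1}. (cmod (a * D01 g t + b * D01 h t))\<^sup>2 = (cmod (D01 (\<lambda>t. a * g t + b * h t) t))\<^sup>2"
      using ae by eventually_elim simp
  qed
  then show ?thesis
    using g h ae m2 by (auto simp: is_w1_def intro: abs_continuous_on_lincomb elim: eventually_mono)
qed

lemma is_w1_zero: "is_w1 (\<lambda>_. 0)"
proof -
  have D: "D01 (\<lambda>_. 0) t = 0" if "t \<in> {0..1}" for t
    using that by (intro D01_eq) auto
  have "integrable (lebesgue_on {0..1}) (\<lambda>t. (cmod (D01 (\<lambda>_. 0) t))\<^sup>2)
     \<longleftrightarrow> integrable (lebesgue_on {0..1::real}) (\<lambda>t. 0::real)"
    by (rule Bochner_Integration.integrable_cong) (auto simp: D)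
  moreover have "D01 (\<lambda>_. 0) \<in> borel_measurable (lebesgue_on {0..1}) \<longleftrightarrow>
     (\<lambda>_. 0::complex) \<in> borel_measurable (lebesgue_on {0..1::real})"
    by (rule measurable_cong) (auto simp: D)
  ultimately show ?thesis
    by (auto simp: is_w1_def intro: lipschitz_imp_abs_continuous_on[where L = 0])
qed

typedef w1 = "{g. is_w1 g}"
  morphisms w1_fun Abs_w1
  using is_w1_zero by blast

setup_lifting type_definition_w1

text \<open>The complex inner product is linear in its first argument.\<close>

definition w1_cinner :: "w1 \<Rightarrow> w1 \<Rightarrow> complex" where
  "w1_cinner g h = w1_fun g 0 * cnj (w1_fun h 0) +
     (LINT t|lebesgue_on {0..1}. D01 (w1_fun g) t * cnj (D01 (w1_fun h) t))"

lift_definition w1_scaleC :: "complex \<Rightarrow> w1 \<Rightarrow> w1" is "\<lambda>c g t. c * g t"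
  using is_w1_lincomb[of _ _ _ 0] by simp

instantiation w1 :: real_vector
begin

lift_definition zero_w1 :: w1 is "\<lambda>_. 0"
  by (rule is_w1_zero)

lift_definition plus_w1 :: "w1 \<Rightarrow> w1 \<Rightarrow> w1" is "\<lambda>g h t. g t + h t"
  using is_w1_lincomb[of _ _ 1 1] by simp

lift_definition minus_w1 :: "w1 \<Rightarrow> w1 \<Rightarrow> w1" is "\<lambda>g h t. g t - h t"
  using is_w1_lincomb[of _ _ 1 "-1"] by simp

lift_definition uminus_w1 :: "w1 \<Rightarrow> w1" is "\<lambda>g t. - g t"
  using is_w1_lincomb[of _ _ "-1" 0] by simp

definition scaleR_w1 :: "real \<Rightarrow> w1 \<Rightarrow> w1" where
  "scaleR_w1 r = w1_scaleC (complex_of_real r)"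

instance
  by standard (unfold scaleR_w1_def, (transfer, simp add: algebra_simps)+)

end

global_interpretation w1: vector_space w1_scaleC
  defines w1_cspan = w1.span
  by standard (transfer, simp add: algebra_simps)+

lemma w1_fun_D01:
  shows w1_fun_outside: "t \<notin> {0..1} \<Longrightarrow> w1_fun g t = 0"
    and w1_abs_continuous: "abs_continuous_on {0..1} (w1_fun g)"
    and w1_differentiable: "AE t in lebesgue_on {0..1}. w1_fun g differentiable (at t within {0..1})"
    and w1_D01_measurable: "D01 (w1_fun g) \<in> borel_measurable (lebesgue_on {0..1})"
    and w1_D01_square: "integrable (lebesgue_on {0..1}) (\<lambda>t. (cmod (D01 (w1_fun g) t))\<^sup>2)"
  using w1_fun[of g] by (simp_all add: is_w1_def)

lemma w1_cinner_integrable: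
  "integrable (lebesgue_on {0..1}) (\<lambda>t. D01 (w1_fun g) t * cnj (D01 (w1_fun h) t))"
  by (intro integrable_square_mult w1_D01_measurable w1_D01_square)

lemma w1_cinner_commute: "w1_cinner g h = cnj (w1_cinner h g)"
proof -
  have "cnj (LINT t|lebesgue_on {0..1}. D01 (w1_fun h) t * cnj (D01 (w1_fun g) t)) =
     (LINT t|lebesgue_on {0..1}. cnj (D01 (w1_fun h) t * cnj (D01 (w1_fun g) t)))"
    by (rule Bochner_Integration.integral_cnj[symmetric])
  then show ?thesis
    by (simp add: w1_cinner_def mult.commute)
qed

lemma w1_cinner_lincomb:
  "w1_cinner (w1_scaleC a g + w1_scaleC b h) k = a * w1_cinner g k + b * w1_cinner h k"
proof -
  have "(LINT t|lebesgue_on {0..1}. D01 (w1_fun (w1_scaleC a g + w1_scaleC b h)) t * cnj (D01 (w1_fun k) t))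
      = (LINT t|lebesgue_on {0..1}. a * (D01 (w1_fun g) t * cnj (D01 (w1_fun k) t))
           + b * (D01 (w1_fun h) t * cnj (D01 (w1_fun k) t)))"
  proof (rule integral_cong_AE)
    show "(\<lambda>t. D01 (w1_fun (w1_scaleC a g + w1_scaleC b h)) t * cnj (D01 (w1_fun k) t)) \<in> borel_measurable (lebesgue_on {0..1})"
      by (intro borel_measurable_integrable w1_cinner_integrable)
    show "(\<lambda>t. a * (D01 (w1_fun g) t * cnj (D01 (w1_fun k) t))
           + b * (D01 (w1_fun h) t * cnj (D01 (w1_fun k) t))) \<in> borel_measurable (lebesgue_on {0..1})"
      by (intro borel_measurable_integrable Bochner_Integration.integrable_add integrable_mult_right w1_cinner_integrable)
    have "w1_fun (w1_scaleC a g + w1_scaleC b h) = (\<lambda>s. a * w1_fun g s + b * w1_fun h s)"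
      by transfer simp
    then show "AE t in lebesgue_on {0..1}. D01 (w1_fun (w1_scaleC a g + w1_scaleC b h)) t * cnj (D01 (w1_fun k) t)
       = a * (D01 (w1_fun g) t * cnj (D01 (w1_fun k) t)) + b * (D01 (w1_fun h) t * cnj (D01 (w1_fun k) t))"
      using AE_D01_lincomb[OF w1_differentiable w1_differentiable, of a g b h]
      by (auto simp: algebra_simps elim: eventually_mono)
  qed
  also have "\<dots> = a * (LINT t|lebesgue_on {0..1}. D01 (w1_fun g) t * cnj (D01 (w1_fun k) t))
      + b * (LINT t|lebesgue_on {0..1}. D01 (w1_fun h) t * cnj (D01 (w1_fun k) t))"
    by (subst Bochner_Integration.integral_add)
       (auto intro!: integrable_mult_right w1_cinner_integrable)
  finally show ?thesis
    unfolding w1_cinner_def by (simp add: plus_w1.rep_eq w1_scaleC.rep_eq algebra_simps)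
qed

lemma w1_scaleC_one [simp]: "w1_scaleC 1 g = g"
  by (rule w1.scale_one)

lemma w1_cinner_add_left: "w1_cinner (g + h) k = w1_cinner g k + w1_cinner h k"
  using w1_cinner_lincomb[of 1 g 1 h k] by simp

lemma w1_cinner_scaleC_left: "w1_cinner (w1_scaleC c g) k = c * w1_cinner g k"
  using w1_cinner_lincomb[of c g 0 g k] by simp

lemma w1_cinner_self:
  "w1_cinner g g = complex_of_real ((cmod (w1_fun g 0))\<^sup>2 +
     (LINT t|lebesgue_on {0..1}. (cmod (D01 (w1_fun g) t))\<^sup>2))"
  by (simp add: w1_cinner_def complex_norm_square[symmetric] del: of_real_power)

lemma w1_FTC:
  assumes "t \<in> {0..1}"
  shows "(D01 (w1_fun g) has_integral (w1_fun g t - w1_fun g 0)) {0..t}"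
proof -
  have "AE s in lebesgue. s \<in> {0..1} \<longrightarrow> w1_fun g differentiable (at s within {0..1})"
    using w1_differentiable[of g] by (simp add: AE_restrict_space_iff)
  then obtain N where N: "N \<in> null_sets lebesgue"
    "\<And>s. s \<notin> N \<Longrightarrow> s \<in> {0..1} \<Longrightarrow> w1_fun g differentiable (at s within {0..1})"
    unfolding completion.AE_iff_null_sets by auto
  show ?thesis
  proof (rule abs_continuous_has_integral[where N = N])
    show "abs_continuous_on {0..t} (w1_fun g)"
      using w1_abs_continuous[of g] assms unfolding abs_continuous_on_def
      by (meson atLeastatMost_subset_iff atLeastAtMost_iff order_refl order_trans)
    show "(w1_fun g has_vector_derivative D01 (w1_fun g) s) (at s within {0..t})"
      if "s \<in> {0..t} - N" for s
    proof (rule has_vector_derivative_within_subset)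
      show "(w1_fun g has_vector_derivative D01 (w1_fun g) s) (at s within {0..1})"
        using N(2)[of s] that assms unfolding D01_def by (simp add: vector_derivative_works)
    qed (use assms in auto)
  qed (use N assms in \<open>auto simp: negligible_iff_null_sets\<close>)
qed

lemma w1_cinner_self_eq_0: "w1_cinner g g = 0 \<longleftrightarrow> g = 0"
proof
  assume "w1_cinner g g = 0"
  then have "(cmod (w1_fun g 0))\<^sup>2 + (LINT t|lebesgue_on {0..1}. (cmod (D01 (w1_fun g) t))\<^sup>2) = 0"
    unfolding w1_cinner_self by (simp only: of_real_eq_0_iff)
  moreover have "0 \<le> (LINT t|lebesgue_on {0..1}. (cmod (D01 (w1_fun g) t))\<^sup>2)"
    by (rule Bochner_Integration.integral_nonneg) simp
  ultimately have 0: "w1_fun g 0 = 0" and "(LINT t|lebesgue_on {0..1}. (cmod (D01 (w1_fun g) t))\<^sup>2) = 0"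
    by (smt (verit) zero_le_power2 norm_eq_zero power2_eq_square mult_eq_0_iff)+
  then have "AE t in lebesgue_on {0..1}. (cmod (D01 (w1_fun g) t))\<^sup>2 = 0"
    by (subst (asm) integral_nonneg_eq_0_iff_AE[OF w1_D01_square]) auto
  then have "AE s in lebesgue. s \<in> {0..1} \<longrightarrow> D01 (w1_fun g) s = 0"
    by (simp add: AE_restrict_space_iff)
  then obtain N where N: "N \<in> null_sets lebesgue" "\<And>s. s \<notin> N \<Longrightarrow> s \<in> {0..1} \<Longrightarrow> D01 (w1_fun g) s = 0"
    unfolding completion.AE_iff_null_sets by auto
  have "w1_fun g t = 0" for t
  proof (cases "t \<in> {0..1}")
    case True
    have "((\<lambda>_. 0) has_integral (w1_fun g t - w1_fun g 0)) {0..t}"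
      by (rule has_integral_spike[OF _ _ w1_FTC[OF True], of N])
         (use N True in \<open>auto simp: negligible_iff_null_sets\<close>)
    then show ?thesis using 0 by (simp add: has_integral_0_eq)
  qed (rule w1_fun_outside)
  then show "g = 0" by transfer auto
next
  assume "g = 0"
  then show "w1_cinner g g = 0" using w1_cinner_scaleC_left[of 0 g g] by simp
qed

instantiation w1 :: real_inner
begin

definition inner_w1 :: "w1 \<Rightarrow> w1 \<Rightarrow> real" where
  "inner_w1 g h = Re (w1_cinner g h)"

definition norm_w1 :: "w1 \<Rightarrow> real" where
  "norm_w1 g = sqrt ((cmod (w1_fun g 0))\<^sup>2 + (LINT t|lebesgue_on {0..1}. (cmod (D01 (w1_fun g) t))\<^sup>2))"

definition sgn_w1 :: "w1 \<Rightarrow> w1" where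
  "sgn_w1 g = g /\<^sub>R norm g"

definition dist_w1 :: "w1 \<Rightarrow> w1 \<Rightarrow> real" where
  "dist_w1 g h = norm (g - h)"

definition uniformity_w1 :: "(w1 \<times> w1) filter" where
  "uniformity_w1 = (INF e\<in>{0<..}. principal {(x, y). dist x y < e})"

definition open_w1 :: "w1 set \<Rightarrow> bool" where
  "open_w1 U \<longleftrightarrow> (\<forall>x\<in>U. \<forall>\<^sub>F (x', y) in uniformity. x' = x \<longrightarrow> y \<in> U)"

instance
proof
  fix x y z :: w1 and r :: real and U :: "w1 set"
  show "dist x y = norm (x - y)" by (rule dist_w1_def)
  show "sgn x = x /\<^sub>R norm x" by (rule sgn_w1_def)
  show "uniformity = (INF e\<in>{0<..}. principal {(x, y :: w1). dist x y < e})"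
    by (rule uniformity_w1_def)
  show "open U \<longleftrightarrow> (\<forall>x\<in>U. \<forall>\<^sub>F (x', y) in uniformity. x' = x \<longrightarrow> y \<in> U)"
    by (rule open_w1_def)
  show "inner x y = inner y x"
    unfolding inner_w1_def by (subst w1_cinner_commute) simp
  show "inner (x + y) z = inner x z + inner y z"
    by (simp add: inner_w1_def w1_cinner_add_left)
  show "inner (r *\<^sub>R x) y = r * inner x y"
    by (simp add: inner_w1_def scaleR_w1_def w1_cinner_scaleC_left)
  have nn: "0 \<le> (LINT t|lebesgue_on {0..1}. (cmod (D01 (w1_fun x) t))\<^sup>2)"
    by (rule Bochner_Integration.integral_nonneg) simp
  show "0 \<le> inner x x"
    using nn by (simp add: inner_w1_def w1_cinner_self del: of_real_add)
  show "inner x x = 0 \<longleftrightarrow> x = 0"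
  proof -
    have "w1_cinner x x = complex_of_real (inner x x)"
      unfolding inner_w1_def w1_cinner_self by (simp only: Re_complex_of_real)
    then show ?thesis using w1_cinner_self_eq_0[of x] by simp
  qed
  show "norm x = sqrt (inner x x)"
    unfolding inner_w1_def w1_cinner_self norm_w1_def by (simp only: Re_complex_of_real)
qed

end


lemma has_vector_derivative_kernel:
  fixes s t :: real
  assumes "t \<in> {0..1}" "t \<noteq> s"
  shows "((\<lambda>t. if t \<in> {0..1} then complex_of_real (1 + min s t) else 0) has_vector_derivative
     (if t < s then 1 else 0)) (at t within {0..1})"
proof (rule has_vector_derivative_transform_within[where d = "\<bar>t - s\<bar>"])
  show "((\<lambda>x. if t < s then complex_of_real (1 + x) else complex_of_real (1 + s)) has_vector_derivative
     (if t < s then 1 else 0)) (at t within {0..1})"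
    by (auto intro!: derivative_eq_intros has_vector_derivative_of_real)
qed (use assms in \<open>auto simp: dist_real_def min_def\<close>)

lemma AE_lebesgue_on_neq: "AE t in lebesgue_on {0..1}. t \<noteq> (s::real)"
  by (subst AE_restrict_space_iff)
     (auto intro!: AE_I'[of "{s}"] simp: negligible_iff_null_sets[symmetric])

lemma AE_D01_kernel:
  "AE t in lebesgue_on {0..1}. (if t < s then 1 else 0) =
     D01 (\<lambda>t. if t \<in> {0..1} then complex_of_real (1 + min s t) else 0) t"
proof -
  have "AE t in lebesgue_on {0..1}. t \<in> {0..1::real}" by (rule AE_I2) auto
  then show ?thesis using AE_lebesgue_on_neq[of s]
  proof eventually_elim
    case (elim t)
    then show ?case using D01_eq[OF _ has_vector_derivative_kernel[of t s]] by simp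
  qed
qed

lemma is_w1_kernel: "is_w1 (\<lambda>t. if t \<in> {0..1} then complex_of_real (1 + min s t) else 0)"
  (is "is_w1 ?k")
  unfolding is_w1_def
proof (intro conjI)
  show "abs_continuous_on {0..1} ?k"
  proof (rule lipschitz_imp_abs_continuous_on[where L = 1])
    fix x y :: real assume "x \<in> {0..1}" "y \<in> {0..1}"
    then have "?k x - ?k y = complex_of_real (min s x - min s y)" by simp
    then show "norm (?k x - ?k y) \<le> 1 * \<bar>x - y\<bar>"
      by (simp only: norm_of_real) auto
  qed
  have "AE t in lebesgue_on {0..1}. t \<in> {0..1::real}" by (rule AE_I2) auto
  then show "AE t in lebesgue_on {0..1}. ?k differentiable (at t within {0..1})"
    using AE_lebesgue_on_neq[of s]
  proof eventually_elim
    case (elim t)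
    then show ?case by (intro differentiableI_vector[OF has_vector_derivative_kernel])
  qed
  have m: "(\<lambda>t::real. if t < s then 1 else 0 :: complex) \<in> borel_measurable (lebesgue_on {0..1})"
    by (rule measurable_restrict_space1) (rule measurable_completion, measurable)
  show m2: "D01 ?k \<in> borel_measurable (lebesgue_on {0..1})"
    by (rule borel_measurable_lebesgue_on_AE[OF m AE_D01_kernel])
  have fin: "finite_measure (lebesgue_on {0..1::real})"
    by (rule finite_measure_lebesgue_on) auto
  have "integrable (lebesgue_on {0..1}) (\<lambda>t. (cmod (if t < s then 1 else 0))\<^sup>2)"
    by (rule finite_measure.integrable_const_bound[OF fin, where B = 1]) (use m in \<open>auto, measurable\<close>)
  then show "integrable (lebesgue_on {0..1}) (\<lambda>t. (cmod (D01 ?k t))\<^sup>2)"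
  proof (rule Bochner_Integration.integrable_cong_AE_imp)
    show "(\<lambda>t. (cmod (D01 ?k t))\<^sup>2) \<in> borel_measurable (lebesgue_on {0..1})"
      using m2 by measurable
    show "AE t in lebesgue_on {0..1}. (cmod (if t < s then 1 else 0))\<^sup>2 = (cmod (D01 ?k t))\<^sup>2"
      using AE_D01_kernel[of s] by eventually_elim simp
  qed
qed auto

text \<open>The reproducing kernel \<open>R(s,t) = 1 + min(s,t)\<close>; \<open>w1_kernel s\<close> is \<open>R(s,\<cdot>)\<close>.\<close>

lift_definition w1_kernel :: "real \<Rightarrow> w1"
  is "\<lambda>s t. if t \<in> {0..1} then complex_of_real (1 + min s t) else 0"
  by (rule is_w1_kernel)

lemma w1_reproducing:
  assumes s: "s \<in> {0..1}"
  shows "w1_cinner g (w1_kernel s) = w1_fun g s"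
proof -
  have fin: "finite_measure (lebesgue_on {0..1::real})"
    by (rule finite_measure_lebesgue_on) auto
  have int1: "integrable (lebesgue_on {0..1}) (D01 (w1_fun g))"
    using integrable_square_mult[OF w1_D01_measurable _ w1_D01_square, of "\<lambda>_. 1" g]
      finite_measure.integrable_const[OF fin] by simp
  have sub: "{0..s} \<subseteq> {0..1::real}" using s by auto
  have ints: "integrable (lebesgue_on {0..s}) (D01 (w1_fun g))"
    using integrable_subinterval[OF int1] sub by blast
  have "(LINT t|lebesgue_on {0..1}. D01 (w1_fun g) t * cnj (D01 (w1_fun (w1_kernel s)) t))
      = (LINT t|lebesgue_on {0..1}. indicat_real {0..s} t *\<^sub>R D01 (w1_fun g) t)"
  proof (rule integral_cong_AE)
    show "(\<lambda>t. D01 (w1_fun g) t * cnj (D01 (w1_fun (w1_kernel s)) t)) \<in> borel_measurable (lebesgue_on {0..1})"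
      by (intro borel_measurable_integrable w1_cinner_integrable)
    have "(indicat_real {0..s}) \<in> borel_measurable (lebesgue_on {0..1})"
      by (intro measurable_restrict_space1 measurable_completion) simp
    then show "(\<lambda>t. indicat_real {0..s} t *\<^sub>R D01 (w1_fun g) t) \<in> borel_measurable (lebesgue_on {0..1})"
      using w1_D01_measurable[of g] by (rule borel_measurable_scaleR)
    have "AE t in lebesgue_on {0..1}. t \<in> {0..1::real}" by (rule AE_I2) auto
    then show "AE t in lebesgue_on {0..1}. D01 (w1_fun g) t * cnj (D01 (w1_fun (w1_kernel s)) t)
        = indicat_real {0..s} t *\<^sub>R D01 (w1_fun g) t"
      using AE_D01_kernel[of s] AE_lebesgue_on_neq[of s]
    proof eventually_elim
      case (elim t)
      have "D01 (w1_fun (w1_kernel s)) t = (if t < s then 1 else 0)"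
        using elim by (simp add: w1_kernel.rep_eq)
      then show ?case using elim by (auto simp: indicator_def)
    qed
  qed
  also have "\<dots> = (LINT t|lebesgue. indicat_real {0..1} t *\<^sub>R (indicat_real {0..s} t *\<^sub>R D01 (w1_fun g) t))"
    by (rule integral_restrict_space) auto
  also have "\<dots> = (LINT t|lebesgue. indicat_real {0..s} t *\<^sub>R D01 (w1_fun g) t)"
    using s by (intro Bochner_Integration.integral_cong) (auto simp: indicator_def)
  also have "\<dots> = (LINT t|lebesgue_on {0..s}. D01 (w1_fun g) t)"
    by (rule integral_restrict_space[symmetric]) auto
  also have "\<dots> = integral {0..s} (D01 (w1_fun g))"
    by (rule lebesgue_integral_eq_integral[OF ints]) auto
  also have "\<dots> = w1_fun g s - w1_fun g 0"
    by (rule integral_unique[OF w1_FTC[OF s]])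
  finally show ?thesis
    using s by (simp add: w1_cinner_def w1_kernel.rep_eq)
qed

lemma w1_cinner_self_norm: "w1_cinner g g = complex_of_real ((norm g)\<^sup>2)"
  unfolding w1_cinner_self norm_w1_def
  by (subst real_sqrt_pow2) (auto intro!: add_nonneg_nonneg Bochner_Integration.integral_nonneg)

section \<open>Operators\<close>

definition w1_tensor :: "w1 \<Rightarrow> w1 \<Rightarrow> w1 \<Rightarrow> w1" where
  "w1_tensor x y = (\<lambda>z. w1_scaleC (w1_cinner z y) x)"

definition bounded_clinear :: "(w1 \<Rightarrow> w1) \<Rightarrow> bool" where
  "bounded_clinear A \<longleftrightarrow> bounded_linear A \<and> (\<forall>c z. A (w1_scaleC c z) = w1_scaleC c (A z))"

definition orthonormal_set :: "w1 set \<Rightarrow> bool" where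
  "orthonormal_set B \<longleftrightarrow> (\<forall>x\<in>B. \<forall>y\<in>B. w1_cinner x y = (if x = y then 1 else 0))"

definition orthonormal_basis :: "w1 set \<Rightarrow> bool" where
  "orthonormal_basis B \<longleftrightarrow>
     orthonormal_set B \<and> (\<forall>z. (\<forall>e\<in>B. w1_cinner z e = 0) \<longrightarrow> z = 0)"

lemma orthonormal_basis_exists: "\<exists>B. orthonormal_basis B"
proof -
  have "\<exists>M\<in>{B. orthonormal_set B}. \<forall>X\<in>{B. orthonormal_set B}. M \<subseteq> X \<longrightarrow> X = M"
  proof (rule subset_Zorn')
    fix \<C> assume C: "subset.chain {B. orthonormal_set B} \<C>"
    have "w1_cinner x y = (if x = y then 1 else 0)" if x: "x \<in> X" "X \<in> \<C>" and y: "y \<in> Y" "Y \<in> \<C>" for x y X Y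
    proof -
      have "X \<subseteq> Y \<or> Y \<subseteq> X"
        using C x y unfolding subset.chain_def by blast
      then show ?thesis
        using C x y unfolding subset.chain_def orthonormal_set_def by blast
    qed
    then show "\<Union>\<C> \<in> {B. orthonormal_set B}" by (auto simp: orthonormal_set_def)
  qed
  then obtain M where M: "orthonormal_set M" "\<And>X. orthonormal_set X \<Longrightarrow> M \<subseteq> X \<Longrightarrow> X = M"
    by auto
  have "z = 0" if z: "\<forall>e\<in>M. w1_cinner z e = 0" for z
  proof (rule ccontr)
    assume "z \<noteq> 0"
    define r where "r = w1_cinner z z"
    have r: "r \<noteq> 0" using \<open>z \<noteq> 0\<close> by (simp add: r_def w1_cinner_self_eq_0)
    have rn: "r = complex_of_real ((norm z)\<^sup>2)"
      unfolding r_def by (rule w1_cinner_self_norm)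
    define w where "w = w1_scaleC (complex_of_real (1 / norm z)) z"
    have zM: "w1_cinner w e = 0" "w1_cinner e w = 0" if "e \<in> M" for e
      using z that w1_cinner_commute[of e w] by (auto simp: w_def w1_cinner_scaleC_left)
    have "w1_cinner w w = complex_of_real (1 / norm z) * (complex_of_real (1 / norm z) * r)"
      unfolding w_def w1_cinner_scaleC_left
      by (subst w1_cinner_commute) (simp add: w1_cinner_scaleC_left r_def[symmetric] rn)
    also have "\<dots> = 1" using r unfolding rn by (simp add: power2_eq_square)
    finally have ww: "w1_cinner w w = 1" .
    then have "orthonormal_set (insert w M)"
      using M(1) zM by (auto simp: orthonormal_set_def)
    then have "w \<in> M" using M(2)[of "insert w M"] by blast
    then show False using zM(1)[of w] ww by simp
  qed
  then show ?thesis using M(1) by (auto simp: orthonormal_basis_def)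
qed

text \<open>
  The trace of a positive operator and the Hilbert--Schmidt norm do not depend on the orthonormal
  basis used to compute them, so one basis is fixed.
\<close>

definition w1_basis :: "w1 set" where
  "w1_basis = (SOME B. orthonormal_basis B)"

lemma orthonormal_basis_w1_basis: "orthonormal_basis w1_basis"
  unfolding w1_basis_def by (rule someI_ex[OF orthonormal_basis_exists])

definition positive_operator :: "(w1 \<Rightarrow> w1) \<Rightarrow> bool" where
  "positive_operator A \<longleftrightarrow> bounded_clinear A \<and> (\<forall>z. w1_cinner (A z) z \<in> \<real>\<^sub>\<ge>\<^sub>0)"

definition positive_trace_class :: "(w1 \<Rightarrow> w1) \<Rightarrow> bool" where
  "positive_trace_class A \<longleftrightarrow>
     positive_operator A \<and> (\<lambda>e. Re (w1_cinner (A e) e)) summable_on w1_basis"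

definition hilbert_schmidt :: "(w1 \<Rightarrow> w1) \<Rightarrow> bool" where
  "hilbert_schmidt A \<longleftrightarrow> bounded_clinear A \<and> (\<lambda>e. (norm (A e))\<^sup>2) summable_on w1_basis"

text \<open>Meaningful only for Hilbert--Schmidt operators: a divergent \<^const>\<open>infsum\<close> is \<open>0\<close>.\<close>

definition hs_norm :: "(w1 \<Rightarrow> w1) \<Rightarrow> real" where
  "hs_norm A = sqrt (\<Sum>\<^sub>\<infinity>e\<in>w1_basis. (norm (A e))\<^sup>2)"

definition orthogonal_projection :: "w1 set \<Rightarrow> w1 \<Rightarrow> w1" where
  "orthogonal_projection V z = (THE v. v \<in> V \<and> (\<forall>w\<in>V. w1_cinner (z - v) w = 0))"

end

theory Submission
  imports Defs
begin

text \<open>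
  Write \<open>\<Pi>f\<Pi> - f = - \<Pi>f(1 - \<Pi>) - (1 - \<Pi>)f\<close> and \<open>d\<^sub>j = \<parallel>(1 - \<Pi>)\<phi>\<^sub>j\<parallel>\<close>. As the \<open>\<phi>\<^sub>j\<close> are
  orthonormal, each of the two terms has squared Hilbert--Schmidt norm at most \<open>\<Sum>\<^sub>j \<nu>\<^sub>j\<^sup>2 d\<^sub>j\<^sup>2\<close>.
  The span of the kernels consists of the continuous piecewise linear functions with nodes \<open>i/m\<close>;
  comparing \<open>\<phi>\<^sub>j\<close> with the one that starts at \<open>\<phi>\<^sub>j(0)\<close> and has slope \<open>\<phi>\<^sub>j'(i/m)\<close> on \<open>(i/m, (i+1)/m)\<close>
  gives \<open>d\<^sub>j \<le> C\<^sub>j/m\<close>. Together with \<open>d\<^sub>j \<le> 1\<close> this yields \<open>d\<^sub>j\<^sup>2 \<le> C\<^sub>j/m\<close>, which is why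
  summability of \<open>C\<^sub>j \<nu>\<^sub>j\<^sup>2\<close> suffices for the rate \<open>m\<^sup>-\<^sup>1\<^sup>/\<^sup>2\<close>.
\<close>

section \<open>Algebra of the complex inner product and Bessel's inequality\<close>

lemma w1_cinner_zero_left [simp]: "w1_cinner 0 k = 0"
  using w1_cinner_scaleC_left[of 0 0 k] by simp

lemma w1_cinner_diff_left: "w1_cinner (g - h) k = w1_cinner g k - w1_cinner h k"
  using w1_cinner_add_left[of "g - h" h k] by simp

lemma w1_cinner_sum_left: "w1_cinner (\<Sum>i\<in>I. g i) k = (\<Sum>i\<in>I. w1_cinner (g i) k)"
  by (induction I rule: infinite_finite_induct) (auto simp: w1_cinner_add_left)

lemma w1_cinner_zero_right [simp]: "w1_cinner k 0 = 0"
  by (subst w1_cinner_commute) simp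

lemma w1_cinner_add_right: "w1_cinner k (g + h) = w1_cinner k g + w1_cinner k h"
  by (subst (1 2 3) w1_cinner_commute) (simp add: w1_cinner_add_left)

lemma w1_cinner_diff_right: "w1_cinner k (g - h) = w1_cinner k g - w1_cinner k h"
  by (subst (1 2 3) w1_cinner_commute) (simp add: w1_cinner_diff_left)

lemma w1_cinner_scaleC_right: "w1_cinner k (w1_scaleC c g) = cnj c * w1_cinner k g"
  by (subst (1 2) w1_cinner_commute) (simp add: w1_cinner_scaleC_left)

lemma w1_cinner_sum_right: "w1_cinner k (\<Sum>i\<in>I. g i) = (\<Sum>i\<in>I. w1_cinner k (g i))"
  by (induction I rule: infinite_finite_induct) (auto simp: w1_cinner_add_right)

lemma w1_norm_square_eq_Re: "(norm g)\<^sup>2 = Re (w1_cinner g g)" for g :: w1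
  by (simp add: w1_cinner_self_norm)

lemma w1_norm_scaleC: "norm (w1_scaleC c g) = cmod c * norm g"
proof -
  have "complex_of_real ((norm (w1_scaleC c g))\<^sup>2) = c * cnj c * complex_of_real ((norm g)\<^sup>2)"
    unfolding w1_cinner_self_norm[symmetric]
    by (simp add: w1_cinner_scaleC_left w1_cinner_scaleC_right)
  also have "\<dots> = complex_of_real ((cmod c * norm g)\<^sup>2)"
    by (simp only: complex_norm_square[symmetric] of_real_mult[symmetric] of_real_power[symmetric]
        power_mult_distrib)
  finally have "(norm (w1_scaleC c g))\<^sup>2 = (cmod c * norm g)\<^sup>2"
    by (simp only: of_real_eq_iff)
  then show ?thesis by (simp add: power2_eq_iff_nonneg)
qed

lemma w1_pythagoras:
  assumes "w1_cinner g h = 0"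
  shows "(norm (g + h))\<^sup>2 = (norm g)\<^sup>2 + (norm h)\<^sup>2"
  unfolding w1_norm_square_eq_Re using assms w1_cinner_commute[of h g]
  by (simp add: w1_cinner_add_left w1_cinner_add_right)

lemma orthonormal_norm_square_sum:
  assumes on: "\<And>i j. i \<in> I \<Longrightarrow> j \<in> I \<Longrightarrow> w1_cinner (\<phi> i) (\<phi> j) = (if i = j then 1 else 0)"
    and I: "finite I"
  shows "(norm (\<Sum>i\<in>I. w1_scaleC (c i) (\<phi> i)))\<^sup>2 = (\<Sum>i\<in>I. (cmod (c i))\<^sup>2)"
proof -
  have "w1_cinner (\<Sum>i\<in>I. w1_scaleC (c i) (\<phi> i)) (\<Sum>i\<in>I. w1_scaleC (c i) (\<phi> i))
      = (\<Sum>i\<in>I. \<Sum>j\<in>I. if i = j then c i * cnj (c i) else 0)"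
    unfolding w1_cinner_sum_left w1_cinner_sum_right
    by (intro sum.cong refl) (auto simp: w1_cinner_scaleC_left w1_cinner_scaleC_right on)
  also have "\<dots> = (\<Sum>i\<in>I. complex_of_real ((cmod (c i))\<^sup>2))"
    using I by (intro sum.cong refl) (simp add: complex_norm_square del: of_real_power)
  finally show ?thesis
    unfolding w1_norm_square_eq_Re by (simp del: of_real_power)
qed

text \<open>The expansion \<open>p\<close> of \<open>z\<close> along \<open>F\<close> has the same
  coefficients as \<open>z\<close>, so \<open>z - p\<close> is orthogonal to \<open>p\<close> and
  Pythagoras applies to \<open>z = (z - p) + p\<close>. The coefficients are written with
  \<open>e\<close> in the first slot because they occur so in the operator expansions; this only
  conjugates them.\<close>

lemma w1_bessel:
  assumes F: "finite F" and on: "orthonormal_set F"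
  shows "(\<Sum>e\<in>F. (cmod (w1_cinner e z))\<^sup>2) \<le> (norm z)\<^sup>2"
proof -
  define p where "p = (\<Sum>e\<in>F. w1_scaleC (w1_cinner z e) e)"
  have onF: "w1_cinner x y = (if x = y then 1 else 0)" if "x \<in> F" "y \<in> F" for x y
    using on that by (auto simp: orthonormal_set_def)
  have "w1_cinner p e = w1_cinner z e" if "e \<in> F" for e
  proof -
    have "w1_cinner p e = (\<Sum>x\<in>F. if x = e then w1_cinner z e else 0)"
      unfolding p_def w1_cinner_sum_left
      by (intro sum.cong refl) (simp add: w1_cinner_scaleC_left onF that)
    then show ?thesis using F that by simp
  qed
  then have "w1_cinner (z - p) p = 0"
    by (subst p_def) (simp add: w1_cinner_sum_right w1_cinner_scaleC_right w1_cinner_diff_left)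
  from w1_pythagoras[OF this] have "(norm p)\<^sup>2 \<le> (norm z)\<^sup>2" by simp
  moreover have "(norm p)\<^sup>2 = (\<Sum>e\<in>F. (cmod (w1_cinner z e))\<^sup>2)"
    unfolding p_def using F onF by (intro orthonormal_norm_square_sum) auto
  moreover have "cmod (w1_cinner e z) = cmod (w1_cinner z e)" for e
    by (subst w1_cinner_commute) simp
  ultimately show ?thesis by simp
qed

section \<open>Values and derivatives of linear combinations\<close>

lemma w1_fun_lincomb: "w1_fun (\<Sum>i\<in>I. w1_scaleC (c i) (g i)) t = (\<Sum>i\<in>I. c i * w1_fun (g i) t)"
  by (induction I rule: infinite_finite_induct)
     (auto simp: zero_w1.rep_eq plus_w1.rep_eq w1_scaleC.rep_eq)

lemma AE_D01_w1_add:
  "AE t in lebesgue_on {0..1}. D01 (w1_fun (w1_scaleC a g + h)) t = a * D01 (w1_fun g) t + D01 (w1_fun h) t"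
proof -
  have "w1_fun (w1_scaleC a g + h) = (\<lambda>s. a * w1_fun g s + 1 * w1_fun h s)"
    by transfer simp
  then show ?thesis
    using AE_D01_lincomb[OF w1_differentiable w1_differentiable, of a g 1 h]
    by (auto elim: eventually_mono)
qed

lemma AE_D01_w1_diff:
  "AE t in lebesgue_on {0..1}. D01 (w1_fun (g - h)) t = D01 (w1_fun g) t - D01 (w1_fun h) t"
proof -
  have "g - h = w1_scaleC (-1) h + g" by transfer simp
  then show ?thesis using AE_D01_w1_add[of "-1" h g] by simp
qed

text \<open>\<open>D01\<close> is arbitrary at points where a function is not differentiable, so
  linearity holds only off a null set; each step of the induction adds one further null set.\<close>

lemma AE_D01_w1_lincomb:
  "AE t in lebesgue_on {0..1}. D01 (w1_fun (\<Sum>i\<in>I. w1_scaleC (c i) (g i))) t = (\<Sum>i\<in>I. c i * D01 (w1_fun (g i)) t)"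
proof (induction I rule: infinite_finite_induct)
  case (insert i I)
  show ?case
    using insert.IH AE_D01_w1_add[of "c i" "g i" "\<Sum>i\<in>I. w1_scaleC (c i) (g i)"]
    by eventually_elim (use insert.hyps in simp)
next
  case empty
  have "AE t in lebesgue_on {0..1}. t \<in> {0..1::real}" by (rule AE_I2) auto
  then show ?case
    by eventually_elim (auto intro!: D01_eq simp: zero_w1.rep_eq[abs_def])
next
  case (infinite I)
  have "AE t in lebesgue_on {0..1}. t \<in> {0..1::real}" by (rule AE_I2) auto
  then show ?case
    by eventually_elim (use infinite in \<open>auto intro!: D01_eq simp: zero_w1.rep_eq[abs_def]\<close>)
qed

section \<open>Sums of squared norms over finite orthonormal sets\<close>

lemma w1_norm_square: "(norm g)\<^sup>2 = (cmod (w1_fun g 0))\<^sup>2 + (LINT t|lebesgue_on {0..1}. (cmod (D01 (w1_fun g) t))\<^sup>2)"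
  for g :: w1
  unfolding norm_w1_def
  by (rule real_sqrt_pow2) (auto intro!: add_nonneg_nonneg Bochner_Integration.integral_nonneg)

text \<open>
  The proof is pointwise in \<open>t\<close>: with \<open>a j = D01 (y j) t\<close> the scalar coefficient of \<open>e\<close> is
  \<open>w1_cinner e (\<Sum>j. cnj (a j) \<phi> j)\<close>, so Bessel's inequality applies before integrating. This avoids
  Parseval's identity, hence completeness of the space.
\<close>

lemma sum_norm_square_orthonormal_right_le:
  fixes \<phi> :: "nat \<Rightarrow> w1"
  assumes F: "finite F" "orthonormal_set F"
    and on: "\<And>i j. w1_cinner (\<phi> i) (\<phi> j) = (if i = j then 1 else 0)"
    and J: "finite J"
  shows "(\<Sum>e\<in>F. (norm (\<Sum>j\<in>J. w1_scaleC (w1_cinner e (\<phi> j)) (y j)))\<^sup>2) \<le> (\<Sum>j\<in>J. (norm (y j))\<^sup>2)"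
proof -
  let ?T = "\<lambda>e. \<Sum>j\<in>J. w1_scaleC (w1_cinner e (\<phi> j)) (y j)"
  have key: "(\<Sum>e\<in>F. (cmod (\<Sum>j\<in>J. w1_cinner e (\<phi> j) * a j))\<^sup>2) \<le> (\<Sum>j\<in>J. (cmod (a j))\<^sup>2)" for a
  proof -
    have "(\<Sum>j\<in>J. w1_cinner e (\<phi> j) * a j) = w1_cinner e (\<Sum>j\<in>J. w1_scaleC (cnj (a j)) (\<phi> j))" for e
      by (simp add: w1_cinner_sum_right w1_cinner_scaleC_right mult.commute)
    then show ?thesis
      using w1_bessel[OF F, of "\<Sum>j\<in>J. w1_scaleC (cnj (a j)) (\<phi> j)"]
        orthonormal_norm_square_sum[of J \<phi> "\<lambda>j. cnj (a j)"] on J by simp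
  qed
  have "AE t in lebesgue_on {0..1}. \<forall>e\<in>F. D01 (w1_fun (?T e)) t = (\<Sum>j\<in>J. w1_cinner e (\<phi> j) * D01 (w1_fun (y j)) t)"
    using F(1) by (intro AE_finite_allI AE_D01_w1_lincomb)
  then have AE: "AE t in lebesgue_on {0..1}. (\<Sum>e\<in>F. (cmod (D01 (w1_fun (?T e)) t))\<^sup>2) \<le> (\<Sum>j\<in>J. (cmod (D01 (w1_fun (y j)) t))\<^sup>2)"
    by eventually_elim (use key in simp)
  have "(\<Sum>e\<in>F. (norm (?T e))\<^sup>2) = (\<Sum>e\<in>F. (cmod (w1_fun (?T e) 0))\<^sup>2)
      + (LINT t|lebesgue_on {0..1}. (\<Sum>e\<in>F. (cmod (D01 (w1_fun (?T e)) t))\<^sup>2))"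
    by (simp add: w1_norm_square sum.distrib w1_D01_square)
  \<comment> \<open>The squared norm has two parts: \<open>key\<close> with the values
    \<open>w1_fun (y j) 0\<close> handles the one at 0, and \<open>AE\<close> the derivative
    part.\<close>
  also have "\<dots> \<le> (\<Sum>j\<in>J. (cmod (w1_fun (y j) 0))\<^sup>2)
      + (LINT t|lebesgue_on {0..1}. (\<Sum>j\<in>J. (cmod (D01 (w1_fun (y j)) t))\<^sup>2))"
    by (intro add_mono integral_mono_AE AE Bochner_Integration.integrable_sum w1_D01_square)
       (simp add: w1_fun_lincomb key)
  also have "\<dots> = (\<Sum>j\<in>J. (norm (y j))\<^sup>2)"
    by (simp add: w1_norm_square sum.distrib w1_D01_square)
  finally show ?thesis .
qed

text \<open>Here the orthonormal vectors are the outputs, so each squared norm is a sum of squared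
  coefficients; after exchanging the sums, Bessel's inequality bounds the sum over \<open>e\<close>
  for each \<open>y j\<close>.\<close>

lemma sum_norm_square_orthonormal_left_le:
  fixes \<phi> :: "nat \<Rightarrow> w1"
  assumes F: "finite F" "orthonormal_set F"
    and on: "\<And>i j. w1_cinner (\<phi> i) (\<phi> j) = (if i = j then 1 else 0)"
    and J: "finite J"
  shows "(\<Sum>e\<in>F. (norm (\<Sum>j\<in>J. w1_scaleC (w1_cinner e (y j)) (\<phi> j)))\<^sup>2) \<le> (\<Sum>j\<in>J. (norm (y j))\<^sup>2)"
proof -
  have "(\<Sum>e\<in>F. (norm (\<Sum>j\<in>J. w1_scaleC (w1_cinner e (y j)) (\<phi> j)))\<^sup>2)
      = (\<Sum>e\<in>F. \<Sum>j\<in>J. (cmod (w1_cinner e (y j)))\<^sup>2)"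
    using on J by (intro sum.cong refl orthonormal_norm_square_sum) auto
  also have "\<dots> = (\<Sum>j\<in>J. \<Sum>e\<in>F. (cmod (w1_cinner e (y j)))\<^sup>2)"
    by (rule sum.swap)
  also have "\<dots> \<le> (\<Sum>j\<in>J. (norm (y j))\<^sup>2)"
    by (intro sum_mono w1_bessel F)
  finally show ?thesis .
qed

section \<open>Orthogonal projection onto a finite-dimensional span\<close>

text \<open>A Gram-Schmidt step: the part \<open>q\<close> of the new vector orthogonal to the old
  span contributes one further term to the projection. The vector \<open>z\<close> is arbitrary in
  the induction because the hypothesis is applied to \<open>k\<close> as well.\<close>

lemma orthogonal_projection_exists:
  assumes "finite K"
  shows "\<exists>v\<in>w1_cspan K. \<forall>w\<in>w1_cspan K. w1_cinner (z - v) w = 0"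
  using assms
proof (induction K arbitrary: z)
  case empty
  show ?case by (auto simp: w1.span_empty)
next
  case (insert k K)
  obtain p where p: "p \<in> w1_cspan K" "\<And>w. w \<in> w1_cspan K \<Longrightarrow> w1_cinner (k - p) w = 0"
    using insert.IH[of k] by blast
  obtain v where v: "v \<in> w1_cspan K" "\<And>w. w \<in> w1_cspan K \<Longrightarrow> w1_cinner (z - v) w = 0"
    using insert.IH[of z] by blast
  define q where "q = k - p"
  define a where "a = w1_cinner (z - v) q / w1_cinner q q"
  have sub: "w \<in> w1_cspan (insert k K)" if "w \<in> w1_cspan K" for w
    using that w1.span_mono[of K "insert k K"] by blast
  have q: "q \<in> w1_cspan (insert k K)"
    unfolding q_def by (intro w1.span_diff sub p(1) w1.span_base) simp
  \<comment> \<open>If \<open>k\<close> already lies in the span of \<open>K\<close>, then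
    \<open>q = 0\<close> and the division returns 0; both sides vanish.\<close>
  have a: "w1_cinner (z - v) q = a * w1_cinner q q"
    by (cases "q = 0") (simp_all add: a_def w1_cinner_self_eq_0)
  show ?case
  proof (intro bexI ballI)
    show "v + w1_scaleC a q \<in> w1_cspan (insert k K)"
      by (intro w1.span_add w1.span_scale sub v(1) q)
    fix w assume "w \<in> w1_cspan (insert k K)"
    then obtain b where b: "w - w1_scaleC b k \<in> w1_cspan K"
      by (auto simp: w1.span_insert)
    \<comment> \<open>Substituting \<open>k = p + q\<close> splits \<open>w\<close> into a vector of
      the old span and a multiple of \<open>q\<close>. The new residual is orthogonal to the former
      because \<open>z - v\<close> and \<open>q\<close> both are, and to \<open>q\<close> by the
      choice of \<open>a\<close>.\<close>
    define w' where "w' = w - w1_scaleC b k + w1_scaleC b p"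
    have w': "w' \<in> w1_cspan K"
      unfolding w'_def by (intro w1.span_add b w1.span_scale p(1))
    have w: "w = w' + w1_scaleC b q"
      by (simp add: w'_def q_def w1.scale_right_diff_distrib)
    have "w1_cinner (z - v - w1_scaleC a q) w = 0"
      unfolding w using a v(2)[OF w'] p(2)[OF w']
      by (simp add: w1_cinner_add_right w1_cinner_scaleC_right w1_cinner_diff_left[of _ "w1_scaleC a q"]
          w1_cinner_scaleC_left q_def[symmetric])
    then show "w1_cinner (z - (v + w1_scaleC a q)) w = 0"
      by (simp add: diff_diff_eq)
  qed
qed

text \<open>The difference of two candidates lies in the span and is orthogonal to itself. This
  identifies the value of the definite description.\<close>

lemma orthogonal_projection_unique:
  assumes "v \<in> w1_cspan K" "\<And>w. w \<in> w1_cspan K \<Longrightarrow> w1_cinner (z - v) w = 0"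
  shows "orthogonal_projection (w1_cspan K) z = v"
  unfolding orthogonal_projection_def
proof (rule the_equality)
  fix u assume u: "u \<in> w1_cspan K \<and> (\<forall>w\<in>w1_cspan K. w1_cinner (z - u) w = 0)"
  then have "w1_cinner (z - u) (u - v) = 0" "w1_cinner (z - v) (u - v) = 0"
    using assms by (blast intro: w1.span_diff)+
  then have "w1_cinner (u - v) (u - v) = 0"
    using w1_cinner_diff_left[of "z - v" "z - u" "u - v"] by simp
  then show "u = v" by (simp add: w1_cinner_self_eq_0)
qed (use assms in blast)

text \<open>Finiteness of \<open>K\<close> guarantees that the projection exists, so
  \<open>P\<close> is given by its characterisation and not by an unspecified value of
  \<open>THE\<close>.\<close>

locale finite_span_projection =
  fixes K :: "w1 set" and P :: "w1 \<Rightarrow> w1"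
  assumes finite: "finite K" and P_def: "P = orthogonal_projection (w1_cspan K)"
begin

lemma in_span: "P z \<in> w1_cspan K"
  and orthogonal: "w \<in> w1_cspan K \<Longrightarrow> w1_cinner (z - P z) w = 0"
proof -
  obtain v where "v \<in> w1_cspan K" "\<And>w. w \<in> w1_cspan K \<Longrightarrow> w1_cinner (z - v) w = 0"
    using orthogonal_projection_exists[OF finite] by blast
  moreover from this have "P z = v" unfolding P_def by (rule orthogonal_projection_unique)
  ultimately show "P z \<in> w1_cspan K" "w \<in> w1_cspan K \<Longrightarrow> w1_cinner (z - P z) w = 0"
    by blast+
qed

text \<open>The sum of the two projections satisfies the characterisation of the projection of the
  sum, so uniqueness gives additivity; \<open>scaleC\<close> is obtained in the same way.\<close>

lemma add: "P (y + z) = P y + P z"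
  unfolding P_def
proof (rule orthogonal_projection_unique, fold P_def)
  fix w assume "w \<in> w1_cspan K"
  then have "w1_cinner ((y - P y) + (z - P z)) w = 0"
    by (simp only: w1_cinner_add_left orthogonal add_0)
  then show "w1_cinner (y + z - (P y + P z)) w = 0" by (simp add: algebra_simps)
qed (intro w1.span_add in_span)

lemma scaleC: "P (w1_scaleC c z) = w1_scaleC c (P z)"
  unfolding P_def
proof (rule orthogonal_projection_unique, fold P_def)
  fix w assume "w \<in> w1_cspan K"
  then show "w1_cinner (w1_scaleC c z - w1_scaleC c (P z)) w = 0"
    by (simp add: w1.scale_right_diff_distrib[symmetric] w1_cinner_scaleC_left orthogonal)
qed (intro w1.span_scale in_span)

lemma norm_square: "(norm z)\<^sup>2 = (norm (z - P z))\<^sup>2 + (norm (P z))\<^sup>2"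
  using w1_pythagoras[OF orthogonal[OF in_span], of z z] by simp

lemma norm_le: "norm (P z) \<le> norm z"
  by (rule power2_le_imp_le) (use norm_square[of z] in auto)

lemma norm_residual_le: "norm (z - P z) \<le> norm z"
  by (rule power2_le_imp_le) (use norm_square[of z] in auto)

text \<open>Pythagoras for \<open>z - v = (z - P z) + (P z - v)\<close>. It lets an explicit element
  of the span bound the residual.\<close>

lemma best_approximation:
  assumes "v \<in> w1_cspan K"
  shows "norm (z - P z) \<le> norm (z - v)"
proof (rule power2_le_imp_le)
  have "w1_cinner (z - P z) (P z - v) = 0"
    by (intro orthogonal w1.span_diff in_span assms)
  from w1_pythagoras[OF this] show "(norm (z - P z))\<^sup>2 \<le> (norm (z - v))\<^sup>2" by simp
qed simp

text \<open>Both sides equal \<open>w1_cinner (z - P z) (y - P y)\<close>. This moves the residual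
  from a basis vector onto an eigenfunction.\<close>

lemma self_adjoint_residual: "w1_cinner (z - P z) y = w1_cinner z (y - P y)"
proof -
  have "w1_cinner (z - P z) (P y) = 0" by (intro orthogonal in_span)
  moreover have "w1_cinner (P z) (y - P y) = 0"
    using orthogonal[OF in_span, of y z] by (subst w1_cinner_commute) simp
  ultimately show ?thesis by (simp add: w1_cinner_diff_left w1_cinner_diff_right)
qed

lemma bounded_clinear: "bounded_clinear P"
  unfolding bounded_clinear_def
  by (intro conjI bounded_linear_intro[where K = 1])
     (auto simp: add scaleC scaleR_w1_def norm_le)

lemma bounded_linear_residual: "bounded_linear (\<lambda>z. z - P z)"
  using bounded_clinear unfolding bounded_clinear_def
  by (intro bounded_linear_sub bounded_linear_ident) simp

end

section \<open>Piecewise linear approximation from the kernel span\<close>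

text \<open>\<open>g'\<close> is an everywhere defined Lipschitz version of the derivative, so its
  node values can serve as slopes even though \<open>g\<close> is only assumed differentiable almost
  everywhere.\<close>

lemma residual_le_lipschitz:
  fixes m :: nat
  assumes m: "0 < m"
    and deriv: "AE t in lebesgue_on {0..1}. (w1_fun g has_vector_derivative g' t) (at t within {0..1})"
    and lip: "\<And>s t. s \<in> {0..1} \<Longrightarrow> t \<in> {0..1} \<Longrightarrow> cmod (g' s - g' t) \<le> C * \<bar>s - t\<bar>"
    and K: "K = (\<lambda>i. w1_kernel (real i / real m)) ` {0..m}"
  shows "\<exists>v\<in>w1_cspan K. norm (g - v) \<le> C / real m"
proof -
  let ?k = "\<lambda>i. w1_kernel (real i / real m)"
  \<comment> \<open>\<open>?k 0\<close> is the constant 1 on \<open>[0,1]\<close>, so the first term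
    matches the value at 0. Each increment \<open>?k (Suc i) - ?k i\<close> vanishes at 0 and has
    slope 1 on its own cell and slope 0 on the others.\<close>
  define v where "v = w1_scaleC (w1_fun g 0) (?k 0)
      + (\<Sum>i<m. w1_scaleC (g' (real i / real m)) (?k (Suc i) - ?k i))"
  have C: "C \<ge> 0" using order_trans[OF norm_ge_zero lip[of 0 1]] by simp
  have "v \<in> w1_cspan K"
    unfolding v_def K
    by (intro w1.span_add w1.span_scale w1.span_sum w1.span_diff w1.span_base imageI) auto
  moreover have "norm (g - v) \<le> C / real m"
  proof (rule power2_le_imp_le)
    have v0: "w1_fun (g - v) 0 = 0"
      by (simp add: v_def minus_w1.rep_eq plus_w1.rep_eq w1_fun_lincomb w1_scaleC.rep_eq w1_kernel.rep_eq)
    have dk: "AE t in lebesgue_on {0..1}. D01 (w1_fun (w1_kernel s)) t = (if t < s then 1 else 0)" for s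
      using AE_D01_kernel[of s] by (auto simp: w1_kernel.rep_eq elim: eventually_mono)
    have dks: "AE t in lebesgue_on {0..1}. \<forall>i\<in>{..m}. D01 (w1_fun (?k i)) t = (if t < real i / real m then 1 else 0)"
      by (intro AE_finite_allI dk) simp
    have dds: "AE t in lebesgue_on {0..1}. \<forall>i\<in>{..<m}. D01 (w1_fun (?k (Suc i) - ?k i)) t
        = D01 (w1_fun (?k (Suc i))) t - D01 (w1_fun (?k i)) t"
      by (intro AE_finite_allI AE_D01_w1_diff) simp
    have sp: "AE t in lebesgue_on {0..1}. t \<in> {0..1::real}" by (rule AE_I2) auto
    have "AE t in lebesgue_on {0..1}. cmod (D01 (w1_fun (g - v)) t) \<le> C / real m"
      using sp AE_lebesgue_on_neq[of 1] deriv dks dds AE_D01_w1_diff[of g v]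
        AE_D01_w1_add[of "w1_fun g 0" "?k 0" "\<Sum>i<m. w1_scaleC (g' (real i / real m)) (?k (Suc i) - ?k i)"]
        AE_D01_w1_lincomb[of "\<lambda>i. g' (real i / real m)" "\<lambda>i. ?k (Suc i) - ?k i" "{..<m}"]
    proof eventually_elim
      case (elim t)
      \<comment> \<open>\<open>n\<close> is the index of the cell containing \<open>t\<close>. The
        point \<open>t = 1\<close> has been discarded because it would give \<open>n = m\<close>,
        outside the range of the sum.\<close>
      define n where "n = nat \<lfloor>t * real m\<rfloor>"
      have t: "0 \<le> t" "t < 1" using elim(1,2) by auto
      have n1: "real n \<le> t * real m" "t * real m < real n + 1"
        using t m unfolding n_def by (auto simp: of_nat_nat le_floor_iff)
      have "t * real m < real m" using t m by simp
      with n1 have n: "n < m" by linarith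
      have *: "D01 (w1_fun (?k (Suc i) - ?k i)) t = (if i = n then 1 else 0)" if "i < m" for i
      proof -
        \<comment> \<open>Hence the difference of the two kernel derivatives is 1 exactly when
          \<open>n < Suc i\<close> but not \<open>n < i\<close>, that is, when
          \<open>i = n\<close>.\<close>
        have "t < real i / real m \<longleftrightarrow> n < i" for i
          using n1 m by (auto simp: field_simps)
        then show ?thesis using elim(4)[rule_format, of i] elim(4)[rule_format, of "Suc i"] elim(5)[rule_format, of i] that
          by (auto simp del: of_nat_Suc)
      qed
      have "D01 (w1_fun v) t = (\<Sum>i<m. g' (real i / real m) * (if i = n then 1 else 0))"
        using elim(7,8) elim(4)[rule_format, of 0] t * by (simp add: v_def del: of_nat_Suc)
      also have "\<dots> = g' (real n / real m)"
        using n by (simp add: if_distrib[of "\<lambda>x. _ * x"] cong: if_cong)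
      finally have "D01 (w1_fun (g - v)) t = g' t - g' (real n / real m)"
        using elim(6) D01_eq[OF elim(1) elim(3)] by simp
      also have "cmod \<dots> \<le> C * \<bar>t - real n / real m\<bar>"
        using n t by (intro lip) auto
      also have "\<dots> \<le> C * (1 / real m)"
      proof (intro mult_left_mono C)
        have "\<bar>t - real n / real m\<bar> = \<bar>t * real m - real n\<bar> / real m"
          using m by (simp add: abs_if field_simps)
        also have "\<dots> \<le> 1 / real m"
          using n1 by (intro divide_right_mono) auto
        finally show "\<bar>t - real n / real m\<bar> \<le> 1 / real m" .
      qed
      finally show ?case by simp
    qed
    then have "(LINT t|lebesgue_on {0..1}. (cmod (D01 (w1_fun (g - v)) t))\<^sup>2)
        \<le> (LINT t|lebesgue_on {0..1::real}. (C / real m)\<^sup>2)"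
    proof (intro integral_mono_AE w1_D01_square)
      show "integrable (lebesgue_on {0..1::real}) (\<lambda>t. (C / real m)\<^sup>2)"
        by (rule finite_measure.integrable_const[OF finite_measure_lebesgue_on]) auto
    qed (auto elim!: eventually_mono intro: power_mono)
    \<comment> \<open>The interval has measure one, so the uniform bound passes unchanged to the
      integral.\<close>
    also have "\<dots> = (C / real m)\<^sup>2"
      by (simp add: measure_restrict_space)
    finally show "(norm (g - v))\<^sup>2 \<le> (C / real m)\<^sup>2"
      by (simp add: w1_norm_square v0)
  qed (use C in simp)
  ultimately show ?thesis by blast
qed

section \<open>Hilbert-Schmidt bound for the projected operator\<close>

text \<open>Bounded finite sums of nonnegative terms give summability, so the \<open>infsum\<close>
  in \<open>hs_norm\<close> is a genuine sum and not the default 0.\<close>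

lemma hs_norm_le:
  assumes "\<And>F. finite F \<Longrightarrow> F \<subseteq> w1_basis \<Longrightarrow> (\<Sum>e\<in>F. (norm (A e))\<^sup>2) \<le> B"
  shows "(\<lambda>e. (norm (A e))\<^sup>2) summable_on w1_basis" and "hs_norm A \<le> sqrt B"
proof -
  show *: "(\<lambda>e. (norm (A e))\<^sup>2) summable_on w1_basis"
    by (rule nonneg_bdd_above_summable_on) (use assms in \<open>auto intro!: bdd_aboveI2\<close>)
  show "hs_norm A \<le> sqrt B"
    unfolding hs_norm_def using infsum_le_finite_sums[OF * assms] by simp
qed

text \<open>Carries bounds for truncated eigenexpansions over to the full operator: \<open>F\<close>
  stays fixed, so convergence at each vector suffices.\<close>

lemma sum_norm_square_limit_le:
  fixes T :: "nat \<Rightarrow> w1 \<Rightarrow> w1"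
  assumes "\<And>e. (\<lambda>n. T n e) \<longlonglongrightarrow> A e" and "\<And>n. (\<Sum>e\<in>F. (norm (T n e))\<^sup>2) \<le> B"
  shows "(\<Sum>e\<in>F. (norm (A e))\<^sup>2) \<le> B"
proof (rule LIMSEQ_le_const2)
  show "(\<lambda>n. \<Sum>e\<in>F. (norm (T n e))\<^sup>2) \<longlonglongrightarrow> (\<Sum>e\<in>F. (norm (A e))\<^sup>2)"
    by (intro tendsto_intros assms)
qed (use assms in blast)

text \<open>The sums for \<open>A (e - P e)\<close> and \<open>A e - P (A e)\<close> are each at
  most \<open>S\<close>; the outer \<open>P\<close> in front of the first is dropped since
  \<open>P\<close> is a contraction. The factor 4 comes from squaring the norm of a sum of two
  terms.\<close>

lemma (in finite_span_projection) projected_difference_bound: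
  assumes A: "bounded_clinear A"
    and on: "\<And>i j. w1_cinner (\<phi> i) (\<phi> j) = (if i = j then 1 else 0)"
    and dec: "\<And>z. (\<lambda>j. \<nu> j *\<^sub>R w1_tensor (\<phi> j) (\<phi> j) z) sums A z"
    and S: "\<And>J. (\<Sum>j<J. (\<nu> j)\<^sup>2 * (norm (\<phi> j - P (\<phi> j)))\<^sup>2) \<le> S"
  shows "hilbert_schmidt (\<lambda>z. P (A (P z)) - A z)" and "hs_norm (\<lambda>z. P (A (P z)) - A z) \<le> sqrt (4 * S)"
proof -
  \<comment> \<open>\<open>y j\<close> combines eigenvalue and residual, so that its squared norms
    are the terms bounded by \<open>S\<close>.\<close>
  define y where "y j = w1_scaleC (complex_of_real (\<nu> j)) (\<phi> j - P (\<phi> j))" for j :: nat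
  have y: "(\<Sum>j<J. (norm (y j))\<^sup>2) \<le> S" for J
    using S[of J] by (simp add: y_def w1_norm_scaleC power_mult_distrib)
  have A_lin: "bounded_linear A" using A by (simp add: bounded_clinear_def)
  have P_lin: "bounded_linear P" using bounded_clinear by (simp add: bounded_clinear_def)
  have R_scaleC: "w1_scaleC c z - P (w1_scaleC c z) = w1_scaleC c (z - P z)" for c z
    by (simp add: scaleC w1.scale_right_diff_distrib)
  have dec_scaleC: "(\<lambda>j. w1_scaleC (complex_of_real (\<nu> j) * w1_cinner z (\<phi> j)) (\<phi> j)) sums A z" for z
    using dec[of z] by (simp add: scaleR_w1_def w1_tensor_def)
  have left: "(\<Sum>e\<in>F. (norm (A (e - P e)))\<^sup>2) \<le> S" if F: "finite F" "orthonormal_set F" for F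
  proof (rule sum_norm_square_limit_le)
    \<comment> \<open>The coefficient of \<open>e - P e\<close> along an eigenfunction, times the
      real eigenvalue, is \<open>w1_cinner e (y j)\<close> by self-adjointness of the
      residual.\<close>
    show "(\<lambda>n. \<Sum>j<n. w1_scaleC (w1_cinner e (y j)) (\<phi> j)) \<longlonglongrightarrow> A (e - P e)" for e
      using dec_scaleC[of "e - P e"]
      by (simp add: sums_def y_def w1_cinner_scaleC_right self_adjoint_residual)
    show "(\<Sum>e\<in>F. (norm (\<Sum>j<n. w1_scaleC (w1_cinner e (y j)) (\<phi> j)))\<^sup>2) \<le> S" for n
      using sum_norm_square_orthonormal_left_le[OF F on, of "{..<n}" y] y[of n] by simp
  qed
  have right: "(\<Sum>e\<in>F. (norm (A e - P (A e)))\<^sup>2) \<le> S" if F: "finite F" "orthonormal_set F" for F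
  proof (rule sum_norm_square_limit_le)
    \<comment> \<open>The residual map is bounded and linear, so it acts termwise on the expansion
      of \<open>A e\<close>.\<close>
    show "(\<lambda>n. \<Sum>j<n. w1_scaleC (w1_cinner e (\<phi> j)) (y j)) \<longlonglongrightarrow> A e - P (A e)" for e
      using bounded_linear.sums[OF bounded_linear_residual dec_scaleC[of e]]
      by (simp add: sums_def y_def R_scaleC mult.commute)
    show "(\<Sum>e\<in>F. (norm (\<Sum>j<n. w1_scaleC (w1_cinner e (\<phi> j)) (y j)))\<^sup>2) \<le> S" for n
      using sum_norm_square_orthonormal_right_le[OF F on, of "{..<n}" y] y[of n] by simp
  qed
  have pt: "(norm (P (A (P e)) - A e))\<^sup>2 \<le> 2 * (norm (A (e - P e)))\<^sup>2 + 2 * (norm (A e - P (A e)))\<^sup>2" for e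
  proof -
    have "P (A (P e)) - A e = - P (A (e - P e)) - (A e - P (A e))"
      by (simp add: bounded_linear.linear[OF A_lin] bounded_linear.linear[OF P_lin] linear_diff)
    then have "norm (P (A (P e)) - A e) \<le> norm (P (A (e - P e))) + norm (A e - P (A e))"
      by (metis norm_minus_cancel norm_triangle_ineq4)
    then have "norm (P (A (P e)) - A e) \<le> norm (A (e - P e)) + norm (A e - P (A e))"
      using norm_le[of "A (e - P e)"] by linarith
    then have "(norm (P (A (P e)) - A e))\<^sup>2 \<le> (norm (A (e - P e)) + norm (A e - P (A e)))\<^sup>2"
      by (rule power_mono) simp
    also have "\<dots> \<le> 2 * (norm (A (e - P e)))\<^sup>2 + 2 * (norm (A e - P (A e)))\<^sup>2"
      using sum_squares_bound[of "norm (A (e - P e))" "norm (A e - P (A e))"]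
      by (simp add: power2_sum)
    finally show ?thesis .
  qed
  have fin: "(\<Sum>e\<in>F. (norm (P (A (P e)) - A e))\<^sup>2) \<le> 4 * S" if F: "finite F" "F \<subseteq> w1_basis" for F
  proof -
    have onF: "orthonormal_set F"
      using orthonormal_basis_w1_basis F(2)
      by (simp add: orthonormal_basis_def orthonormal_set_def subset_iff)
    have "(\<Sum>e\<in>F. (norm (P (A (P e)) - A e))\<^sup>2)
        \<le> 2 * (\<Sum>e\<in>F. (norm (A (e - P e)))\<^sup>2) + 2 * (\<Sum>e\<in>F. (norm (A e - P (A e)))\<^sup>2)"
      unfolding sum_distrib_left sum.distrib[symmetric] by (intro sum_mono pt)
    also have "\<dots> \<le> 4 * S" using left[OF F(1) onF] right[OF F(1) onF] by simp
    finally show ?thesis .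
  qed
  have "bounded_linear (\<lambda>z. P (A (P z)) - A z)"
    by (intro bounded_linear_sub A_lin bounded_linear_compose[OF P_lin]
        bounded_linear_compose[OF A_lin] P_lin)
  then show "hilbert_schmidt (\<lambda>z. P (A (P z)) - A z)"
    using A hs_norm_le(1)[OF fin]
    by (simp add: hilbert_schmidt_def bounded_clinear_def scaleC w1.scale_right_diff_distrib)
  show "hs_norm (\<lambda>z. P (A (P z)) - A z) \<le> sqrt (4 * S)"
    by (rule hs_norm_le(2)[OF fin])
qed

theorem theorem8p2:
  fixes f :: "real ^ 'd \<Rightarrow> w1 \<Rightarrow> w1"
    and f_tilde :: "nat \<Rightarrow> real ^ 'd \<Rightarrow> w1 \<Rightarrow> w1"
    and \<theta> :: "real ^ 'd"
    and \<nu> :: "nat \<Rightarrow> real"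
    and \<phi> :: "nat \<Rightarrow> w1"
    and \<phi>' :: "nat \<Rightarrow> real \<Rightarrow> complex"
    and C :: "nat \<Rightarrow> real"
    and m :: "nat \<Rightarrow> nat"
    and u :: "nat \<Rightarrow> nat \<Rightarrow> real"
    and Proj :: "nat \<Rightarrow> w1 \<Rightarrow> w1"
  assumes f_positive_trace_class: "positive_trace_class (f \<theta>)"
    and phi_orthonormal: "\<And>i j. w1_cinner (\<phi> i) (\<phi> j) = (if i = j then 1 else 0)"
    and f_decomposition: "\<And>z. (\<lambda>j. \<nu> j *\<^sub>R w1_tensor (\<phi> j) (\<phi> j) z) sums f \<theta> z"
    and nu_summable: "summable \<nu>"
    and phi_derivative: "\<And>j. AE t in lebesgue_on {0..1}.
          (w1_fun (\<phi> j) has_vector_derivative \<phi>' j t) (at t within {0..1})"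
    and phi_derivative_lipschitz: "\<And>j s t. s \<in> {0..1} \<Longrightarrow> t \<in> {0..1} \<Longrightarrow>
          cmod (\<phi>' j s - \<phi>' j t) \<le> C j * \<bar>s - t\<bar>"
    and C_nu_summable: "summable (\<lambda>j. C j * (\<nu> j)\<^sup>2)"
    and m_positive: "\<And>n. 0 < m n"
    and m_tendsto: "filterlim m at_top sequentially"
    and design: "\<And>n i. i \<le> m n \<Longrightarrow> u n i = real i / real (m n)"
    and projection: "\<And>n. Proj n = orthogonal_projection (w1_cspan ((\<lambda>i. w1_kernel (u n i)) ` {0..m n}))"
    and f_tilde: "\<And>n. f_tilde n \<theta> = Proj n \<circ> f \<theta> \<circ> Proj n"
  shows "(\<forall>n. hilbert_schmidt (\<lambda>z. f_tilde n \<theta> z - f \<theta> z)) \<and>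
    (\<lambda>n. hs_norm (\<lambda>z. f_tilde n \<theta> z - f \<theta> z)) \<in> O(\<lambda>n. real (m n) powr (- 1 / 2))"
proof -
  define S where "S = (\<Sum>j. C j * (\<nu> j)\<^sup>2)"
  \<comment> \<open>The Lipschitz bound for the points 0 and 1 forces the sign; with it, partial
    sums are at most \<open>S\<close>.\<close>
  have C: "C j \<ge> 0" for j
    using order_trans[OF norm_ge_zero phi_derivative_lipschitz[of 0 1 j]] by simp
  have main: "hilbert_schmidt (\<lambda>z. f_tilde n \<theta> z - f \<theta> z) \<and>
      hs_norm (\<lambda>z. f_tilde n \<theta> z - f \<theta> z) \<le> sqrt (4 * (S / real (m n)))" for n
  proof -
    let ?K = "(\<lambda>i. w1_kernel (real i / real (m n))) ` {0..m n}"
    \<comment> \<open>\<open>design\<close> fixes \<open>u n i\<close> only for \<open>i\<close> up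
      to \<open>m n\<close>, which is exactly the index range of the image.\<close>
    have K: "?K = (\<lambda>i. w1_kernel (u n i)) ` {0..m n}"
      by (rule image_cong) (simp_all add: design)
    interpret finite_span_projection ?K "Proj n"
      by standard (simp_all add: projection K)
    have d: "(norm (\<phi> j - Proj n (\<phi> j)))\<^sup>2 \<le> C j / real (m n)" for j
    proof -
      have "norm (\<phi> j) = 1"
        using w1_norm_square_eq_Re[of "\<phi> j"] phi_orthonormal[of j j] norm_ge_zero[of "\<phi> j"]
        by (simp add: power2_eq_1_iff)
      then have 1: "norm (\<phi> j - Proj n (\<phi> j)) \<le> 1"
        using norm_residual_le[of "\<phi> j"] by simp
      have 2: "norm (\<phi> j - Proj n (\<phi> j)) \<le> C j / real (m n)"
        using residual_le_lipschitz[OF m_positive phi_derivative phi_derivative_lipschitz refl]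
          best_approximation order_trans by blast
      show ?thesis
        unfolding power2_eq_square using mult_mono[OF 1 2] by simp
    qed
    have "(\<Sum>j<J. (\<nu> j)\<^sup>2 * (norm (\<phi> j - Proj n (\<phi> j)))\<^sup>2) \<le> S / real (m n)" for J
    proof -
      have "(\<Sum>j<J. (\<nu> j)\<^sup>2 * (norm (\<phi> j - Proj n (\<phi> j)))\<^sup>2) \<le> (\<Sum>j<J. (\<nu> j)\<^sup>2 * (C j / real (m n)))"
        by (intro sum_mono mult_left_mono d) simp
      also have "\<dots> = (\<Sum>j<J. C j * (\<nu> j)\<^sup>2) / real (m n)"
        by (simp add: sum_divide_distrib mult.commute)
      also have "\<dots> \<le> S / real (m n)"
        unfolding S_def using C by (intro divide_right_mono sum_le_suminf C_nu_summable) auto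
      finally show ?thesis .
    qed
    moreover have "bounded_clinear (f \<theta>)"
      using f_positive_trace_class by (simp add: positive_trace_class_def positive_operator_def)
    ultimately show ?thesis
      using projected_difference_bound[of "f \<theta>" \<phi> \<nu> "S / real (m n)", OF _ phi_orthonormal f_decomposition]
      by (simp add: f_tilde)
  qed
  have "hs_norm (\<lambda>z. f_tilde n \<theta> z - f \<theta> z) \<le> sqrt (4 * S) * real (m n) powr (- 1 / 2)" for n
    using main[of n] by (simp add: real_sqrt_divide powr_minus powr_half_sqrt divide_simps)
  moreover have "hs_norm A \<ge> 0" for A
    by (simp add: hs_norm_def infsum_nonneg)
  ultimately show ?thesis
    using main by (auto intro!: bigoI[where c = "sqrt (4 * S)"] always_eventually)
qed

end
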